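(* Let $\Phi=(G,\varphi)$ be a $\mathbb{T}$-gain graph on a simple graph $G$ with matching number $\mu$ and maximum edge degree $\Delta_e$. (A) If $\Delta_e$ is even, then $\mathcal{E}(\Phi)\le 2\mu\sqrt{2\Delta_e+1}$, with equality if and only if $\Phi$ is the disjoint union of $\mu$ copies of $\mathbb{T}$-gain graphs $(P_2,\varphi)$ and some isolated vertices. (B) If $\Delta_e$ is odd, then $\mathcal{E}(\Phi)\le \mu\left(\sqrt{b+2\sqrt b}+\sqrt{b-2\sqrt b}\right)$ where $b=2(\Delta_e+1)$, with equality if and only if $\Phi$ is the disjoint union of $\mu$ copies of $\mathbb{T}$-gain graphs $(P_3,\varphi)$ and some isolated vertices.
   Context: Let $\mathbb{T}=\{z\in\mathbb{C}:|z|=1\}$. A $\mathbb{T}$-gain graph $\Phi=(G,\varphi)$ is a simple graph $G$ with a map $\varphi$ assigning to each oriented edge $\vec e_{p,q}$ a value in $\mathbb{T}$ with $\varphi(\vec{e}_{p,q})=\varphi(\vec{e}_{q,p})^{-1}$; its adjacency matrix has $(p,q)$ entry $\varphi(\vec{e}_{p,q})$ if $v_p\sim v_q$ and $0$ otherwise, and its energy $\mathcal{E}(\Phi)$ is the sum of absolute values of the eigenvalues of this matrix. The matching number is the maximum size of a set of pairwise non-adjacent edges of $G$. The degree of an edge $e$ is the number of other edges sharing an endpoint with $e$, and $\Delta_e$ is the maximum edge degree of $G$. $P_k$ denotes the path on $k$ vertices. *)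

theory Defs
  imports
    Complex_Main
    "HOL-Computational_Algebra.Computational_Algebra"
    "Jordan_Normal_Form.Char_Poly"
    "Graph_Theory.Pair_Digraph"
    "Graph_Theory.Digraph_Isomorphism"
begin

text \<open>
  A finite simple graph is a \<^locale>\<open>pair_graph\<close>: a finite loop-free symmetric digraph
  without parallel arcs.  Its arcs are the oriented edges; an undirected edge is the
  two-element set of its endpoints.
\<close>

definition edges :: "'a pair_pre_digraph \<Rightarrow> 'a set set" where
  "edges G = {{u, v} | u v. (u, v) \<in> parcs G}"

definition adjacent_edges :: "'a set \<Rightarrow> 'a set \<Rightarrow> bool" where
  "adjacent_edges e f \<longleftrightarrow> e \<noteq> f \<and> e \<inter> f \<noteq> {}"

definition matching :: "'a pair_pre_digraph \<Rightarrow> 'a set set \<Rightarrow> bool" where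
  "matching G M \<longleftrightarrow> M \<subseteq> edges G \<and> (\<forall>e\<in>M. \<forall>f\<in>M. \<not> adjacent_edges e f)"

definition matching_number :: "'a pair_pre_digraph \<Rightarrow> nat" where
  "matching_number G = Max {card M | M. matching G M}"

definition edge_degree :: "'a pair_pre_digraph \<Rightarrow> 'a set \<Rightarrow> nat" where
  "edge_degree G e = card {f \<in> edges G. adjacent_edges e f}"

text \<open>Inserting \<open>0\<close> fixes the convention that an edgeless graph has maximum edge degree \<open>0\<close>.\<close>

definition max_edge_degree :: "'a pair_pre_digraph \<Rightarrow> nat" where
  "max_edge_degree G = Max (insert 0 (edge_degree G ` edges G))"

locale gain_graph = pair_graph G for G :: "'a pair_pre_digraph" +
  fixes \<phi> :: "'a \<times> 'a \<Rightarrow> complex"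
  assumes gain_in_circle: "(u, v) \<in> parcs G \<Longrightarrow> \<phi> (u, v) \<in> {z. cmod z = 1}"
    and gain_reverse: "(u, v) \<in> parcs G \<Longrightarrow> \<phi> (u, v) = inverse (\<phi> (v, u))"

text \<open>The list \<open>vs\<close> is the numbering of the vertices that indexes rows and columns.\<close>

definition adj_mat :: "'a pair_pre_digraph \<Rightarrow> ('a \<times> 'a \<Rightarrow> complex) \<Rightarrow> 'a list \<Rightarrow> complex mat" where
  "adj_mat G \<phi> vs = mat (length vs) (length vs)
     (\<lambda>(p, q). if (vs ! p, vs ! q) \<in> parcs G then \<phi> (vs ! p, vs ! q) else 0)"

text \<open>
  The multiset \<^term>\<open>proots (char_poly A)\<close> lists the eigenvalues of \<open>A\<close> with their
  algebraic multiplicities.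
\<close>

definition energy :: "'a pair_pre_digraph \<Rightarrow> ('a \<times> 'a \<Rightarrow> complex) \<Rightarrow> 'a list \<Rightarrow> real" where
  "energy G \<phi> vs = (\<Sum>z\<in>#proots (char_poly (adj_mat G \<phi> vs)). cmod z)"

definition path_graph :: "nat \<Rightarrow> nat pair_pre_digraph" where
  "path_graph k = \<lparr>pverts = {..<k},
     parcs = {(i, j). i < k \<and> j < k \<and> (j = Suc i \<or> i = Suc j)}\<rparr>"

definition gain_path :: "nat \<Rightarrow> 'a pair_pre_digraph \<Rightarrow> ('a \<times> 'a \<Rightarrow> complex) \<Rightarrow> bool" where
  "gain_path k H \<phi> \<longleftrightarrow> gain_graph H \<phi> \<and> digraph_iso (with_proj H) (with_proj (path_graph k))"

text \<open>
  \<open>(G, \<phi>)\<close> is the vertex-disjoint union of \<open>m\<close> gain graphs on the path with \<open>k\<close> vertices and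
  a (possibly empty) set \<open>I\<close> of isolated vertices.  Each copy carries the restriction of \<open>\<phi>\<close>
  to its own arcs, so different copies may carry different gains.
\<close>

definition disjoint_gain_paths ::
    "nat \<Rightarrow> nat \<Rightarrow> 'a pair_pre_digraph \<Rightarrow> ('a \<times> 'a \<Rightarrow> complex) \<Rightarrow> bool" where
  "disjoint_gain_paths m k G \<phi> \<longleftrightarrow> (\<exists>\<H> I.
     finite \<H> \<and> card \<H> = m \<and>
     (\<forall>H\<in>\<H>. gain_path k H \<phi>) \<and>
     (\<forall>H\<in>\<H>. \<forall>H'\<in>\<H>. H \<noteq> H' \<longrightarrow> pverts H \<inter> pverts H' = {}) \<and>
     (\<forall>H\<in>\<H>. pverts H \<inter> I = {}) \<and>
     pverts G = (\<Union>H\<in>\<H>. pverts H) \<union> I \<and>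
     parcs G = (\<Union>H\<in>\<H>. parcs H))"

end

theory Submission
  imports Defs "Jordan_Normal_Form.Schur_Decomposition" "HOL-Analysis.Convex"
begin

text \<open>
  Let \<open>S\<close> be the sign of the Hermitian adjacency matrix \<open>A\<close>, a Hermitian unitary matrix with
  \<open>E = tr (A S)\<close>.  Then \<open>E = 2 \<Sum> Y e\<close> over the edges \<open>e = {u, v}\<close>, where
  \<open>Y e = Re (A u v * S v u)\<close>, and since the rows of \<open>S\<close> are unit vectors the squares of the
  weights \<open>Y e\<close> at any vertex sum to at most \<open>1\<close>.  Given a maximum matching \<open>M\<close>, assign every other
  edge to one of its \<open>M\<close>-covered endpoints.  If \<open>p\<close> and \<open>q\<close> edges are assigned to the two ends of
  \<open>e \<in> M\<close>, then \<open>p + q \<le> \<Delta>\<close>, and by Cauchy-Schwarz \<open>e\<close> and these edges have total weight at most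
  \<open>a + (\<surd>p + \<surd>q) \<surd>(1 - a\<^sup>2) \<le> \<surd>(1 + (\<surd>p + \<surd>q)\<^sup>2)\<close>, where \<open>a = Y e\<close>.  The integer inequality
  \<open>4 p q \<le> \<Delta>\<^sup>2 - \<Delta> mod 2\<close> yields both bounds.  Equality prescribes the weight of every edge, which
  is contradictory for \<open>\<Delta> \<ge> 2\<close> and leaves copies of \<open>P\<^sub>2\<close> (\<open>\<Delta> = 0\<close>) or \<open>P\<^sub>3\<close> (\<open>\<Delta> = 1\<close>).
\<close>

section \<open>Unitary diagonalisation of Hermitian matrices\<close>

lemma mat_adjoint_dim [simp]:
  "dim_row (mat_adjoint A) = dim_col A" "dim_col (mat_adjoint A) = dim_row A"
  by (auto simp: mat_adjoint_def)

lemma mat_adjoint_carrier [simp]: "A \<in> carrier_mat n m \<Longrightarrow> mat_adjoint A \<in> carrier_mat m n"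
  by (auto simp: mat_adjoint_def)

lemma mat_adjoint_index [simp]:
  "i < dim_col A \<Longrightarrow> j < dim_row A \<Longrightarrow> mat_adjoint A $$ (i, j) = conjugate (A $$ (j, i))"
  by (simp add: mat_adjoint_def mat_of_rows_index)

lemma mat_adjoint_adjoint [simp]: "mat_adjoint (mat_adjoint A) = A"
  by (rule eq_matI) auto

lemma mat_adjoint_one: "mat_adjoint (1\<^sub>m n :: complex mat) = 1\<^sub>m n"
  by (rule eq_matI) auto

lemma mat_adjoint_mult:
  fixes A B :: "complex mat"
  assumes "A \<in> carrier_mat n m" "B \<in> carrier_mat m k"
  shows "mat_adjoint (A * B) = mat_adjoint B * mat_adjoint A"
proof (rule eq_matI)
  fix i j assume "i < dim_row (mat_adjoint B * mat_adjoint A)"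
    "j < dim_col (mat_adjoint B * mat_adjoint A)"
  then show "mat_adjoint (A * B) $$ (i, j) = (mat_adjoint B * mat_adjoint A) $$ (i, j)"
    using assms by (auto simp: scalar_prod_def mult.commute intro!: sum.cong)
qed (use assms in auto)

text \<open>Deflation step of the spectral theorem: an eigenvector is completed to a basis, and
  Gram-Schmidt orthogonalises that basis without changing its first vector.\<close>

lemma unitary_with_eigenvector:
  fixes A :: "complex mat"
  assumes A: "A \<in> carrier_mat (Suc n) (Suc n)"
  obtains W e where "W \<in> carrier_mat (Suc n) (Suc n)" "mat_adjoint W * W = 1\<^sub>m (Suc n)"
    "A *\<^sub>v col W 0 = e \<cdot>\<^sub>v col W 0"
proof -
  let ?n = "Suc n"
  obtain es where es: "char_poly A = (\<Prod>a\<leftarrow>es. [:- a, 1:])" "length es = ?n"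
    using char_poly_factorized[OF A] by blast
  then obtain e es' where "es = e # es'" by (cases es) auto
  then have "eigenvalue A e"
    unfolding eigenvalue_root_char_poly[OF A] using es by simp
  define v where "v = find_eigenvector A e"
  have "eigenvector A v e" using find_eigenvector[OF A \<open>eigenvalue A e\<close>] v_def by simp
  then have v [simp]: "v \<in> carrier_vec ?n" and v0: "v \<noteq> 0\<^sub>v ?n" and ev: "A *\<^sub>v v = e \<cdot>\<^sub>v v"
    using A unfolding eigenvector_def by auto
  define b where "b = basis_completion v"
  define ws where "ws = gram_schmidt ?n b"
  interpret cof_vec_space ?n "TYPE(complex)" .
  from basis_completion[OF v v0, folded b_def]
  have span_b: "span (set b) = carrier_vec ?n" and dist_b: "distinct b"
    and indep: "\<not> lin_dep (set b)" and b: "set b \<subseteq> carrier_vec ?n" and hdb: "hd b = v"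
    and len_b: "length b = ?n" by auto
  from hdb len_b obtain bs where bv: "b = v # bs" by (cases b) auto
  from gram_schmidt_result[OF b dist_b indep refl, folded ws_def]
  have ws: "set ws \<subseteq> carrier_vec ?n" "corthogonal ws" "length ws = ?n"
    by (auto simp: len_b)
  from gram_schmidt_hd[OF v, of bs, folded bv] have "hd ws = v" unfolding ws_def .
  then have ws0: "ws ! 0 = v" using ws(3) by (cases ws) auto
  have wsc: "ws ! j \<in> carrier_vec ?n" if "j < ?n" for j using ws that by auto
  define c where "c j = (\<Sum>k<?n. (cmod (ws ! j $ k))\<^sup>2)" for j
  have ip: "(\<Sum>k<?n. ws ! i $ k * cnj (ws ! j $ k)) = (if i = j then of_real (c i) else 0)"
    and c_pos: "c i > 0" if "i < ?n" "j < ?n" for i j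
  proof -
    have eq: "ws ! i \<bullet>c ws ! j = (\<Sum>k<?n. ws ! i $ k * cnj (ws ! j $ k))" if "j < ?n" for j
      using wsc[OF that] by (simp add: scalar_prod_def lessThan_atLeast0)
    have self: "(\<Sum>k<?n. ws ! i $ k * cnj (ws ! i $ k)) = of_real (c i)"
      unfolding c_def of_real_sum by (rule sum.cong) (simp_all only: complex_norm_square)
    have "ws ! i \<bullet>c ws ! j = 0 \<longleftrightarrow> i \<noteq> j" "ws ! i \<bullet>c ws ! i \<noteq> 0"
      using corthogonalD[OF ws(2)] that ws(3) by auto
    then show "(\<Sum>k<?n. ws ! i $ k * cnj (ws ! j $ k)) = (if i = j then of_real (c i) else 0)"
      using eq[of j] self that by auto
    have "c i \<noteq> 0" using \<open>ws ! i \<bullet>c ws ! i \<noteq> 0\<close> eq[of i] self that by auto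
    moreover have "c i \<ge> 0" unfolding c_def by (intro sum_nonneg) simp
    ultimately show "c i > 0" by simp
  qed
  \<comment> \<open>The Gram-Schmidt vectors are orthogonal and nonzero but not normalised, so each
    column is divided by its norm \<open>sqrt (c j)\<close>.\<close>
  define W where "W = mat ?n ?n (\<lambda>(i, j). ws ! j $ i / of_real (sqrt (c j)))"
  have W: "W \<in> carrier_mat ?n ?n" by (simp add: W_def)
  have "mat_adjoint W * W = 1\<^sub>m ?n"
  proof (rule eq_matI)
    fix i j assume "i < dim_row (1\<^sub>m ?n :: complex mat)" "j < dim_col (1\<^sub>m ?n :: complex mat)"
    then have ij: "i < ?n" "j < ?n" by auto
    have "(mat_adjoint W * W) $$ (i, j) =
        (\<Sum>k<?n. cnj (ws ! i $ k / of_real (sqrt (c i))) * (ws ! j $ k / of_real (sqrt (c j))))"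
      using ij W by (simp add: scalar_prod_def lessThan_atLeast0 W_def del: complex_cnj_divide)
    also have "\<dots> = (\<Sum>k<?n. ws ! j $ k * cnj (ws ! i $ k)) / of_real (sqrt (c i) * sqrt (c j))"
      unfolding sum_divide_distrib by (rule sum.cong) (auto simp: field_simps)
    also have "\<dots> = 1\<^sub>m ?n $$ (i, j)"
      using ip[OF ij(2,1)] ij c_pos[OF ij(1) ij(1)] by (auto simp flip: of_real_mult)
    finally show "(mat_adjoint W * W) $$ (i, j) = 1\<^sub>m ?n $$ (i, j)" .
  qed (use W in auto)
  moreover have "col W 0 = (1 / of_real (sqrt (c 0))) \<cdot>\<^sub>v v"
    using v by (intro eq_vecI) (auto simp: W_def ws0 carrier_vecD[OF v])
  then have "A *\<^sub>v col W 0 = e \<cdot>\<^sub>v col W 0"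
    using ev A by (simp add: mult_mat_vec smult_smult_assoc mult.commute)
  ultimately show ?thesis using that W by blast
qed

text \<open>Conjugation by \<open>W\<close> turns the first column into a multiple of the first unit
  vector. The result is still Hermitian, so its first row vanishes off the diagonal as well; the
  matrix splits into blocks and the induction hypothesis diagonalises the lower one.\<close>

theorem hermitian_unitary_diagonalisation:
  fixes A :: "complex mat"
  assumes "A \<in> carrier_mat n n" "mat_adjoint A = A"
  shows "\<exists>U D. similar_mat_wit A D U (mat_adjoint U) \<and> diagonal_mat D"
  using assms
proof (induction n arbitrary: A)
  case 0
  then have "similar_mat_wit A A (1\<^sub>m 0) (mat_adjoint (1\<^sub>m 0))"
    unfolding mat_adjoint_one by (intro similar_mat_wit_refl)
  moreover have "diagonal_mat A" using 0 by (auto simp: diagonal_mat_def)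
  ultimately show ?case by blast
next
  case (Suc n)
  let ?n = "Suc n"
  note A = Suc.prems(1)
  obtain W e where W: "W \<in> carrier_mat ?n ?n" and WW: "mat_adjoint W * W = 1\<^sub>m ?n"
    and ev: "A *\<^sub>v col W 0 = e \<cdot>\<^sub>v col W 0"
    using unitary_with_eigenvector[OF A] .
  have W': "mat_adjoint W \<in> carrier_mat ?n ?n" using W by simp
  have WW': "W * mat_adjoint W = 1\<^sub>m ?n" using mat_mult_left_right_inverse[OF W' W WW] .
  define B where "B = mat_adjoint W * (A * W)"
  have B: "B \<in> carrier_mat ?n ?n" using A W W' unfolding B_def by (intro mult_carrier_mat) auto
  have B_herm: "mat_adjoint B = B"
    using A W W' Suc.prems(2) by (simp add: B_def mat_adjoint_mult[of _ ?n ?n _ ?n] mult_carrier_mat[of _ ?n ?n] assoc_mult_mat[of _ ?n ?n _ ?n _ ?n])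
  have "W * B * mat_adjoint W = (W * mat_adjoint W) * A * (W * mat_adjoint W)"
    using A W W' by (simp add: B_def mult_carrier_mat[of _ ?n ?n] assoc_mult_mat[of _ ?n ?n _ ?n _ ?n])
  then have "A = W * B * mat_adjoint W" using A WW' by simp
  then have AB: "similar_mat_wit A B W (mat_adjoint W)"
    by (rule similar_mat_witI[OF WW' WW _ A B W W'])
  have B0: "B $$ (i, 0) = (if i = 0 then e else 0)" if "i < ?n" for i
  proof -
    have "B $$ (i, 0) = row (mat_adjoint W) i \<bullet> (e \<cdot>\<^sub>v col W 0)"
    proof -
      have "col (A * W) 0 = A *\<^sub>v col W 0" using A W by (intro eq_vecI) auto
      then have "col (A * W) 0 = e \<cdot>\<^sub>v col W 0" using ev by simp
      moreover have "B $$ (i, 0) = row (mat_adjoint W) i \<bullet> col (A * W) 0"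
        using that A W W' unfolding B_def by (intro index_mult_mat) auto
      ultimately show ?thesis by simp
    qed
    also have "\<dots> = e * (mat_adjoint W * W) $$ (i, 0)"
      using that W W' by simp
    finally show ?thesis using that WW by simp
  qed
  have B0': "B $$ (0, i) = (if i = 0 then e else 0)" if "i < ?n" for i
  proof -
    have "B $$ (0, i) = mat_adjoint B $$ (0, i)" by (simp add: B_herm)
    also have "\<dots> = cnj (B $$ (i, 0))" using that B by simp
    finally have "B $$ (0, i) = cnj (B $$ (i, 0))" .
    then show ?thesis using B0[OF that] B0[of 0] by (auto split: if_splits)
  qed
  define C where "C = mat n n (\<lambda>(i, j). B $$ (Suc i, Suc j))"
  have C: "C \<in> carrier_mat n n" by (simp add: C_def)
  have B_block: "B = four_block_mat (mat 1 1 (\<lambda>_. e)) (0\<^sub>m 1 n) (0\<^sub>m n 1) C"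
    using B B0 B0' by (intro eq_matI) (auto simp: C_def)
  have "mat_adjoint C = C"
  proof (rule eq_matI)
    fix i j assume "i < dim_row C" "j < dim_col C"
    then have ij: "i < n" "j < n" by (auto simp: C_def)
    then have "mat_adjoint B $$ (Suc i, Suc j) = B $$ (Suc i, Suc j)" by (simp add: B_herm)
    then show "mat_adjoint C $$ (i, j) = C $$ (i, j)" using ij B by (simp add: C_def)
  qed (auto simp: C_def)
  then obtain U D where UD: "similar_mat_wit C D U (mat_adjoint U)" "diagonal_mat D"
    using Suc.IH[OF C] by blast
  note UDc = similar_mat_witD2[OF C UD(1)]
  let ?blk = "\<lambda>U. four_block_mat (1\<^sub>m 1) (0\<^sub>m 1 n) (0\<^sub>m n 1) U :: complex mat"
  define E where "E = four_block_mat (mat 1 1 (\<lambda>_. e)) (0\<^sub>m 1 n) (0\<^sub>m n 1) D"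
  have BE: "similar_mat_wit B E (?blk U) (?blk (mat_adjoint U))"
    unfolding B_block E_def
    by (rule similar_mat_wit_four_block[OF similar_mat_wit_refl UD(1)]) (use UDc C in auto)
  have adj: "?blk (mat_adjoint U) = mat_adjoint (?blk U)"
    using UDc by (intro eq_matI) auto
  have "similar_mat_wit A E (W * ?blk U) (mat_adjoint (?blk U) * mat_adjoint W)"
    using similar_mat_wit_trans[OF AB BE] unfolding adj .
  also have "mat_adjoint (?blk U) * mat_adjoint W = mat_adjoint (W * ?blk U)"
    using W UDc by (subst mat_adjoint_mult[of _ ?n ?n _ ?n]) auto
  finally have "similar_mat_wit A E (W * ?blk U) (mat_adjoint (W * ?blk U))" .
  moreover have "diagonal_mat E"
    using UD(2) UDc by (auto simp: E_def diagonal_mat_def)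
  ultimately show ?case by blast
qed

section \<open>Traces, products and eigenvalues under a common similarity\<close>

definition mat_trace :: "'a :: comm_ring_1 mat \<Rightarrow> 'a" where
  "mat_trace X = (\<Sum>i<dim_row X. X $$ (i, i))"

lemma mat_trace_mult:
  assumes "X \<in> carrier_mat n m" "Y \<in> carrier_mat m n"
  shows "mat_trace (X * Y) = (\<Sum>i<n. \<Sum>j<m. X $$ (i, j) * Y $$ (j, i))"
  using assms by (auto simp: mat_trace_def scalar_prod_def lessThan_atLeast0 intro!: sum.cong)

lemma mat_trace_comm:
  assumes "X \<in> carrier_mat n m" "Y \<in> carrier_mat m n"
  shows "mat_trace (X * Y) = mat_trace (Y * X)"
  unfolding mat_trace_mult[OF assms] mat_trace_mult[OF assms(2,1)]
  by (subst sum.swap) (simp add: mult.commute)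

lemma mat_trace_similar:
  assumes "A \<in> carrier_mat n n" "similar_mat_wit A B P Q"
  shows "mat_trace A = mat_trace B"
proof -
  note w = similar_mat_witD2[OF assms]
  have "mat_trace A = mat_trace ((P * B) * Q)" using w(3) by simp
  also have "\<dots> = mat_trace (Q * (P * B))"
    by (rule mat_trace_comm[OF mult_carrier_mat[OF w(6,5)] w(7)])
  also have "Q * (P * B) = Q * P * B" by (rule assoc_mult_mat[OF w(7,6,5), symmetric])
  also have "\<dots> = B" unfolding w(2) by (rule left_mult_one_mat[OF w(5)])
  finally show ?thesis .
qed

lemma mat_trace_mat_diag: "mat_trace (mat_diag n d) = (\<Sum>i<n. d i)"
  by (simp add: mat_trace_def mat_diag_def)

text \<open>The inner factor \<open>Q * P\<close> cancels. Through this, identities between products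
  of \<open>A\<close> and its sign matrix can be checked on diagonal matrices.\<close>

lemma similar_mat_wit_mult:
  assumes AB: "similar_mat_wit A B P Q" and AB': "similar_mat_wit A' B' P Q"
  shows "similar_mat_wit (A * A') (B * B') P Q"
proof -
  define n where "n = dim_row A"
  note w = similar_mat_witD[OF n_def AB]
  have "n = dim_row A'"
    using similar_mat_witD(6)[OF refl AB'] w(6) by auto
  note w' = similar_mat_witD[OF this AB']
  have "A * A' = (P * B * Q) * (P * B' * Q)" using w(3) w'(3) by simp
  also have "\<dots> = P * (B * (Q * P) * B') * Q"
    using w(4-7) w'(4,5) by (simp add: assoc_mult_mat[of _ n n _ n _ n] mult_carrier_mat[of _ n n])
  also have "\<dots> = P * (B * B') * Q" using w(2,5) by simp
  finally show ?thesis
    by (intro similar_mat_witI[OF w(1,2)] mult_carrier_mat[of _ n n _ n] w w')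
qed

lemma proots_char_poly_similar_diagonal:
  fixes A :: "'a :: idom mat"
  assumes "similar_mat A D" "D \<in> carrier_mat n n" "diagonal_mat D"
  shows "proots (char_poly A) = {#D $$ (i, i). i \<in># mset_set {..<n}#}"
proof -
  have "char_poly A = (\<Prod>a\<leftarrow>diag_mat D. [:- a, 1:])"
    using assms by (subst char_poly_similar[OF assms(1)], intro char_poly_upper_triangular)
      (auto simp: upper_triangular_def diagonal_mat_def)
  also have "proots \<dots> = mset (diag_mat D)"
  proof -
    have "proots (\<Prod>a\<leftarrow>xs. [:- a, 1:]) = mset xs" for xs :: "'a list"
    proof (induction xs)
      case (Cons a xs)
      have "(\<Prod>a\<leftarrow>xs. [:- a, 1:]) \<noteq> 0" by (auto simp: prod_list_zero_iff)
      then have "proots ([:- a, 1:] * (\<Prod>a\<leftarrow>xs. [:- a, 1:])) =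
          proots [:- a, 1:] + proots (\<Prod>a\<leftarrow>xs. [:- a, 1:])"
        by (intro proots_mult) auto
      then show ?case using Cons by simp
    qed simp
    then show ?thesis .
  qed
  also have "\<dots> = {#D $$ (i, i). i \<in># mset_set {..<n}#}"
    using assms(2) by (simp add: diag_mat_def lessThan_atLeast0)
  finally show ?thesis .
qed

context
  fixes A :: "complex mat" and n :: nat
  assumes A: "A \<in> carrier_mat n n" and herm: "mat_adjoint A = A"
begin

lemma hermitian_real_diagonalisation:
  obtains U d where "similar_mat_wit A (mat_diag n (\<lambda>i. complex_of_real (d i))) U (mat_adjoint U)"
    "(\<Sum>z\<in>#proots (char_poly A). cmod z) = (\<Sum>i<n. \<bar>d i\<bar>)"
proof -
  obtain U D where UD: "similar_mat_wit A D U (mat_adjoint U)" and diag: "diagonal_mat D"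
    using hermitian_unitary_diagonalisation[OF A herm] by blast
  note w = similar_mat_witD2[OF A UD]
  have D: "D = mat_adjoint U * A * U"
    using similar_mat_witD(3)[OF refl similar_mat_wit_sym[OF UD]] .
  have "mat_adjoint D = D"
    using w(4-7) herm unfolding D
    by (simp add: mat_adjoint_mult[of _ n n _ n] mult_carrier_mat[of _ n n] assoc_mult_mat[of _ n n _ n _ n])
  then have "cnj (D $$ (i, i)) = D $$ (i, i)" if "i < n" for i
    using that w(5) mat_adjoint_index[of i D i] by simp
  then have real: "D $$ (i, i) = of_real (Re (D $$ (i, i)))" if "i < n" for i
    using that by (simp add: complex_eq_iff)
  define d where "d i = Re (D $$ (i, i))" for i
  have "D = mat_diag n (\<lambda>i. complex_of_real (d i))"
    using w(5) diag real by (intro eq_matI) (auto simp: mat_diag_def diagonal_mat_def d_def)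
  moreover have "(\<Sum>z\<in>#proots (char_poly A). cmod z) = (\<Sum>i<n. \<bar>d i\<bar>)"
  proof -
    have "similar_mat A D" using UD by (auto simp: similar_mat_def)
    then have "(\<Sum>z\<in>#proots (char_poly A). cmod z) = (\<Sum>i<n. cmod (D $$ (i, i)))"
      using proots_char_poly_similar_diagonal[OF _ w(5) diag]
      by (simp add: sum_unfold_sum_mset image_mset.compositionality o_def)
    also have "\<dots> = (\<Sum>i<n. \<bar>d i\<bar>)"
      using real by (intro sum.cong) (auto simp: d_def, metis norm_of_real)
    finally show ?thesis .
  qed
  ultimately show ?thesis using that UD by blast
qed

text \<open>In an eigenbasis of \<open>A\<close>, each eigenvalue is replaced by its sign; then
  \<open>A * S\<close> has the eigenvalues \<open>\<bar>d i\<bar>\<close>, and its trace is their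
  sum.\<close>

lemma hermitian_sign_matrix:
  obtains S where "S \<in> carrier_mat n n" "mat_adjoint S = S" "S * S = 1\<^sub>m n"
    "(\<Sum>z\<in>#proots (char_poly A). cmod z) = Re (mat_trace (A * S))"
proof -
  obtain U d where UD: "similar_mat_wit A (mat_diag n (\<lambda>i. complex_of_real (d i))) U (mat_adjoint U)"
    and sum: "(\<Sum>z\<in>#proots (char_poly A). cmod z) = (\<Sum>i<n. \<bar>d i\<bar>)"
    by (rule hermitian_real_diagonalisation)
  note w = similar_mat_witD2[OF A UD]
  \<comment> \<open>A zero eigenvalue receives sign 1 rather than 0, so that \<open>T * T\<close> is
    the identity even for singular \<open>A\<close>.\<close>
  define t :: "nat \<Rightarrow> complex" where "t i = (if d i \<ge> 0 then 1 else -1)" for i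
  define T where "T = mat_diag n t"
  define S where "S = U * T * mat_adjoint U"
  have T: "T \<in> carrier_mat n n" and S: "S \<in> carrier_mat n n"
    using w(6,7) by (auto simp: T_def S_def)
  have "mat_adjoint T = T" by (rule eq_matI) (auto simp: T_def t_def mat_diag_def)
  then have S_herm: "mat_adjoint S = S"
    using w(6,7) T unfolding S_def
    by (simp add: mat_adjoint_mult[of _ n n _ n] mult_carrier_mat[of _ n n] assoc_mult_mat[of _ n n _ n _ n])
  have ST: "similar_mat_wit S T U (mat_adjoint U)"
    by (rule similar_mat_witI[OF w(1,2) S_def S T w(6,7)])
  have "(\<lambda>i. t i * t i) = (\<lambda>_. 1)" by (auto simp: t_def)
  then have "T * T = 1\<^sub>m n" by (simp add: T_def)
  then have "S * S = 1\<^sub>m n"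
    using similar_mat_witD(3)[OF refl similar_mat_wit_mult[OF ST ST]] w(1,6,7) by simp
  moreover have "mat_trace (A * S) = (\<Sum>i<n. of_real (d i) * t i)"
    using mat_trace_similar[OF mult_carrier_mat[OF A S] similar_mat_wit_mult[OF UD ST]]
    by (simp add: T_def mat_trace_mat_diag)
  moreover have "\<dots> = of_real (\<Sum>i<n. \<bar>d i\<bar>)"
    unfolding of_real_sum by (intro sum.cong) (auto simp: t_def)
  ultimately show ?thesis using that[OF S S_herm] sum by simp
qed

text \<open>The cube identity passes to each eigenvalue \<open>d\<close>, so \<open>d = 0\<close> or
  \<open>d^2 = c\<close>, and in both cases \<open>\<bar>d\<bar> * sqrt c = d^2\<close>. This
  evaluates the energy of the extremal graphs without computing their characteristic
  polynomials.\<close>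

lemma hermitian_cube_eigenvalue_sum:
  assumes cube: "A * A * A = of_real c \<cdot>\<^sub>m A"
  shows "(\<Sum>z\<in>#proots (char_poly A). cmod z) * sqrt c = Re (mat_trace (A * A))"
proof -
  obtain U d where UD: "similar_mat_wit A (mat_diag n (\<lambda>i. complex_of_real (d i))) U (mat_adjoint U)"
    and sum: "(\<Sum>z\<in>#proots (char_poly A). cmod z) = (\<Sum>i<n. \<bar>d i\<bar>)"
    by (rule hermitian_real_diagonalisation)
  define D where "D = mat_diag n (\<lambda>i. complex_of_real (d i))"
  note UD = UD[folded D_def]
  note sim = similar_mat_wit_mult[OF similar_mat_wit_mult[OF UD UD] UD]
  have "D * D * D = mat_adjoint U * (A * A * A) * U"
    using similar_mat_witD(3)[OF refl similar_mat_wit_sym[OF sim]] .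
  also have "\<dots> = of_real c \<cdot>\<^sub>m D"
    unfolding cube
    by (rule similar_mat_witD(3)[OF refl similar_mat_wit_sym[OF similar_mat_wit_smult[OF UD]], symmetric])
  finally have D3: "D * D * D = of_real c \<cdot>\<^sub>m D" .
  have "complex_of_real (d i * d i * d i) = of_real (c * d i)" if "i < n" for i
  proof -
    have "complex_of_real (d i * d i * d i) = (D * D * D) $$ (i, i)"
      using that unfolding D_def mat_diag_diag by (simp add: mat_diag_def)
    also have "\<dots> = (of_real c \<cdot>\<^sub>m D) $$ (i, i)" by (simp only: D3)
    also have "\<dots> = of_real (c * d i)"
      using that unfolding D_def by (simp add: mat_diag_def)
    finally show ?thesis .
  qed
  then have cubes: "d i * d i * d i = c * d i" if "i < n" for i
    using that by (simp only: of_real_eq_iff)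
  have "\<bar>d i\<bar> * sqrt c = (d i)\<^sup>2" if "i < n" for i
  proof (cases "d i = 0")
    case False
    then have "c = (d i)\<^sup>2" using cubes[OF that] by (simp add: power2_eq_square)
    then show ?thesis by (simp add: power2_eq_square)
  qed simp
  moreover have "mat_trace (A * A) = of_real (\<Sum>i<n. (d i)\<^sup>2)"
    using mat_trace_similar[OF mult_carrier_mat[OF A A] similar_mat_wit_mult[OF UD UD]]
    by (simp add: D_def mat_trace_mat_diag power2_eq_square)
  ultimately show ?thesis by (simp add: sum sum_distrib_right)
qed

end

section \<open>Edge weights representing the energy\<close>

context pair_graph
begin

lemma arc_sym: "(u, v) \<in> parcs G \<longleftrightarrow> (v, u) \<in> parcs G"
  using pair_sym_arcs by (auto simp: symmetric_def sym_def)

lemma arc_irrefl: "(u, u) \<notin> parcs G"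
  using pair_no_loops by force

lemma arc_verts: "(u, v) \<in> parcs G \<Longrightarrow> u \<in> pverts G \<and> v \<in> pverts G"
  by (auto dest: in_arcsD1 in_arcsD2)

lemma edge_iff_arc: "{u, v} \<in> edges G \<longleftrightarrow> (u, v) \<in> parcs G"
  unfolding edges_def using arc_sym by (auto simp: doubleton_eq_iff)

lemma edgeE:
  assumes "e \<in> edges G"
  obtains u v where "e = {u, v}" "(u, v) \<in> parcs G" "u \<noteq> v"
  using assms arc_irrefl unfolding edges_def by blast

lemma edges_conv_image: "edges G = (\<lambda>p. {fst p, snd p}) ` parcs G"
  unfolding edges_def by force

lemma finite_edges: "finite (edges G)"
  unfolding edges_conv_image using pair_finite_arcs by simp

lemma edge_subset: "e \<in> edges G \<Longrightarrow> e \<subseteq> pverts G"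
  using arc_verts unfolding edges_def by blast

lemma card_edge: "e \<in> edges G \<Longrightarrow> card e = 2"
  by (erule edgeE) simp

lemma sum_parcs_edges:
  fixes g :: "'a set \<Rightarrow> real"
  shows "(\<Sum>p\<in>parcs G. g {fst p, snd p}) = 2 * (\<Sum>e\<in>edges G. g e)"
proof -
  have two: "(\<Sum>p\<in>{p \<in> parcs G. {fst p, snd p} = e}. g {fst p, snd p}) = 2 * g e" if e: "e \<in> edges G" for e
  proof -
    obtain u v where uv: "e = {u, v}" "(u, v) \<in> parcs G" "u \<noteq> v" using edgeE[OF e] .
    then have "{p \<in> parcs G. {fst p, snd p} = e} = {(u, v), (v, u)}"
      using arc_sym by (auto simp: doubleton_eq_iff)
    then show ?thesis using uv by (simp add: insert_commute)
  qed
  have "(\<Sum>p\<in>parcs G. g {fst p, snd p})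
      = (\<Sum>e\<in>edges G. \<Sum>p\<in>{p \<in> parcs G. {fst p, snd p} = e}. g {fst p, snd p})"
    by (rule sum.group[symmetric]) (auto simp: pair_finite_arcs finite_edges edges_conv_image)
  also have "\<dots> = (\<Sum>e\<in>edges G. 2 * g e)"
    by (intro sum.cong refl two)
  finally show ?thesis by (simp add: sum_distrib_left)
qed

lemma sum_incident_edges:
  fixes g :: "'a set \<Rightarrow> real"
  shows "(\<Sum>e\<in>{e \<in> edges G. u \<in> e}. g e) = (\<Sum>x\<in>{x. (u, x) \<in> parcs G}. g {u, x})"
proof -
  have "{e \<in> edges G. u \<in> e} = (\<lambda>x. {u, x}) ` {x. (u, x) \<in> parcs G}"
    using arc_sym by (auto simp: edge_iff_arc elim!: edgeE)
  moreover have "inj_on (\<lambda>x. {u, x}) {x. (u, x) \<in> parcs G}"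
    by (auto simp: inj_on_def doubleton_eq_iff)
  ultimately show ?thesis by (simp add: sum.reindex)
qed

end

locale numbered_gain_graph = gain_graph +
  fixes vs
  assumes distinct_vs: "distinct vs" and set_vs: "set vs = pverts G"
begin

abbreviation "A \<equiv> adj_mat G \<phi> vs"
abbreviation "n \<equiv> length vs"

definition gain :: "'a \<Rightarrow> 'a \<Rightarrow> complex" where
  "gain u v = (if (u, v) \<in> parcs G then \<phi> (u, v) else 0)"

lemma gain_cnj: "cnj (gain u v) = gain v u"
proof (cases "(u, v) \<in> parcs G")
  case True
  then have "cmod (\<phi> (u, v)) = 1" "\<phi> (v, u) = inverse (\<phi> (u, v))"
    using gain_in_circle[of u v] gain_reverse[of v u] arc_sym[of u v] by simp_all
  moreover from this(1) have "\<phi> (u, v) * cnj (\<phi> (u, v)) = 1"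
    using complex_norm_square[of "\<phi> (u, v)"] by simp
  then have "inverse (\<phi> (u, v)) = cnj (\<phi> (u, v))" by (rule inverse_unique)
  ultimately show ?thesis using True arc_sym[of u v] by (simp add: gain_def)
next
  case False
  then show ?thesis using arc_sym[of u v] by (simp add: gain_def)
qed

lemma gain_sq: "gain u v * gain v u = of_bool ((u, v) \<in> parcs G)"
proof (cases "(u, v) \<in> parcs G")
  case True
  then have "cmod (gain u v) = 1" using gain_in_circle by (simp add: gain_def)
  then have "gain u v * cnj (gain u v) = 1" using complex_norm_square[of "gain u v"] by simp
  then show ?thesis using True by (simp add: gain_cnj)
qed (simp add: gain_def)

lemma A_carrier: "A \<in> carrier_mat n n"
  by (simp add: adj_mat_def)

lemma A_index: "i < n \<Longrightarrow> j < n \<Longrightarrow> A $$ (i, j) = gain (vs ! i) (vs ! j)"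
  by (simp add: adj_mat_def gain_def)

lemma A_hermitian: "mat_adjoint A = A"
proof (rule eq_matI)
  fix i j assume "i < dim_row A" "j < dim_col A"
  then show "mat_adjoint A $$ (i, j) = A $$ (i, j)"
    using A_carrier by (simp add: A_index gain_cnj)
qed (use A_carrier in auto)

lemma sum_nth_vs: "(\<Sum>i<n. f (vs ! i)) = (\<Sum>u\<in>pverts G. f u)"
  by (rule sum.reindex_bij_betw[OF bij_betw_nth]) (auto simp: distinct_vs set_vs)

lemma sum_nth_vs2: "(\<Sum>i<n. \<Sum>j<n. f (vs ! i) (vs ! j)) = (\<Sum>u\<in>pverts G. \<Sum>x\<in>pverts G. f u x)"
proof -
  have "(\<Sum>i<n. \<Sum>j<n. f (vs ! i) (vs ! j)) = (\<Sum>i<n. \<Sum>x\<in>pverts G. f (vs ! i) x)"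
    by (intro sum.cong refl sum_nth_vs)
  also have "\<dots> = (\<Sum>u\<in>pverts G. \<Sum>x\<in>pverts G. f u x)" by (rule sum_nth_vs)
  finally show ?thesis .
qed

text \<open>The two arcs of \<open>e\<close> together contribute \<open>2 * Y e\<close> to the trace
  of \<open>A * S\<close>. Gains have modulus 1, so \<open>\<bar>Y e\<bar>\<close> is at most the
  modulus of an entry of \<open>S\<close>; the rows of \<open>S\<close> are unit vectors because
  \<open>S\<close> is Hermitian and squares to the identity.\<close>

lemma energy_edge_weights:
  obtains Y :: "'a set \<Rightarrow> real" where
    "energy G \<phi> vs = 2 * (\<Sum>e\<in>edges G. Y e)"
    "\<forall>u. (\<Sum>e\<in>{e \<in> edges G. u \<in> e}. (Y e)\<^sup>2) \<le> 1"
proof -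
  obtain S where S: "S \<in> carrier_mat n n" and S_herm: "mat_adjoint S = S" and SS: "S * S = 1\<^sub>m n"
    and en: "energy G \<phi> vs = Re (mat_trace (A * S))"
    using hermitian_sign_matrix[OF A_carrier A_hermitian] unfolding energy_def .
  define ix where "ix = the_inv_into {..<n} ((!) vs)"
  have ix: "ix (vs ! i) = i" if "i < n" for i
    unfolding ix_def using that distinct_vs
    by (intro the_inv_into_f_f) (auto simp: inj_on_def nth_eq_iff_index_eq)
  \<comment> \<open>The entries of \<open>S\<close>, indexed by vertices instead of positions in
    \<open>vs\<close>.\<close>
  define \<sigma> where "\<sigma> u x = S $$ (ix u, ix x)" for u x
  have S_cnj: "cnj (S $$ (i, j)) = S $$ (j, i)" if "i < n" "j < n" for i j
    using that S mat_adjoint_index[of j S i] by (simp add: S_herm)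
  have \<sigma>_cnj: "cnj (\<sigma> u x) = \<sigma> x u" if "u \<in> pverts G" "x \<in> pverts G" for u x
    using that S_cnj ix unfolding set_vs[symmetric] in_set_conv_nth \<sigma>_def by auto
  have \<sigma>_norm: "(\<Sum>x\<in>pverts G. (cmod (\<sigma> u x))\<^sup>2) = 1" if u: "u \<in> pverts G" for u
  proof -
    obtain i where i: "i < n" "u = vs ! i" using u unfolding set_vs[symmetric] in_set_conv_nth by blast
    have "complex_of_real (\<Sum>x\<in>pverts G. (cmod (\<sigma> u x))\<^sup>2)
        = (\<Sum>j<n. of_real ((cmod (\<sigma> u (vs ! j)))\<^sup>2))"
      unfolding of_real_sum by (rule sum_nth_vs[symmetric])
    also have "\<dots> = (\<Sum>j<n. S $$ (i, j) * S $$ (j, i))"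
      using i by (intro sum.cong) (simp_all add: complex_norm_square \<sigma>_def ix S_cnj del: of_real_power)
    also have "\<dots> = (S * S) $$ (i, i)"
      using S i by (simp add: scalar_prod_def lessThan_atLeast0)
    also have "\<dots> = 1" using i by (simp add: SS)
    finally show ?thesis by (simp only: of_real_eq_1_iff)
  qed
  define y where "y u x = Re (gain u x * cnj (\<sigma> u x))" for u x
  have y_sym: "y u x = y x u" if "u \<in> pverts G" "x \<in> pverts G" for u x
  proof -
    have "gain x u * cnj (\<sigma> x u) = cnj (gain u x * cnj (\<sigma> u x))"
      using that by (simp add: gain_cnj \<sigma>_cnj)
    then show ?thesis by (simp add: y_def)
  qed
  have y_le: "(y u x)\<^sup>2 \<le> (cmod (\<sigma> u x))\<^sup>2" if "(u, x) \<in> parcs G" for u x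
  proof -
    have "\<bar>y u x\<bar> \<le> cmod (gain u x * cnj (\<sigma> u x))" unfolding y_def by (rule abs_Re_le_cmod)
    also have "\<dots> = cmod (\<sigma> u x)"
      using that gain_in_circle by (simp add: norm_mult gain_def)
    finally show ?thesis by (simp add: power2_le_iff_abs_le)
  qed
  \<comment> \<open>Since \<open>y\<close> is symmetric, the orientation picked by
    \<open>SOME\<close> does not affect the value.\<close>
  define Y where "Y e = (let p = SOME p. p \<in> parcs G \<and> {fst p, snd p} = e in y (fst p) (snd p))" for e
  have Y: "Y {u, x} = y u x" if "(u, x) \<in> parcs G" for u x
  proof -
    define p where "p = (SOME p. p \<in> parcs G \<and> {fst p, snd p} = {u, x})"
    have "\<exists>p. p \<in> parcs G \<and> {fst p, snd p} = {u, x}"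
      using that by force
    then have "p \<in> parcs G \<and> {fst p, snd p} = {u, x}"
      unfolding p_def by (rule someI_ex)
    then have "y (fst p) (snd p) = y u x"
      using y_sym[of u x] arc_verts[OF that] by (auto simp: doubleton_eq_iff)
    then show ?thesis by (simp add: Y_def p_def Let_def)
  qed
  have "mat_trace (A * S) = (\<Sum>i<n. \<Sum>j<n. gain (vs ! i) (vs ! j) * cnj (\<sigma> (vs ! i) (vs ! j)))"
    unfolding mat_trace_mult[OF A_carrier S]
    by (intro sum.cong) (simp_all add: A_index \<sigma>_def ix S_cnj)
  then have "energy G \<phi> vs = (\<Sum>i<n. \<Sum>j<n. y (vs ! i) (vs ! j))"
    by (simp add: en y_def)
  also have "\<dots> = (\<Sum>u\<in>pverts G. \<Sum>x\<in>pverts G. y u x)"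
    by (rule sum_nth_vs2[where f = "y"])
  also have "\<dots> = (\<Sum>p\<in>pverts G \<times> pverts G. y (fst p) (snd p))"
    by (simp add: sum.cartesian_product case_prod_unfold)
  also have "\<dots> = (\<Sum>p\<in>parcs G. y (fst p) (snd p))"
    using pair_finite_verts arc_verts by (intro sum.mono_neutral_right) (auto simp: y_def gain_def)
  also have "\<dots> = (\<Sum>p\<in>parcs G. Y {fst p, snd p})"
    by (intro sum.cong) (auto simp: Y)
  also have "\<dots> = 2 * (\<Sum>e\<in>edges G. Y e)" by (rule sum_parcs_edges)
  finally have "energy G \<phi> vs = 2 * (\<Sum>e\<in>edges G. Y e)" .
  moreover have "(\<Sum>e\<in>{e \<in> edges G. u \<in> e}. (Y e)\<^sup>2) \<le> 1" for u
  proof (cases "u \<in> pverts G")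
    case True
    have "(\<Sum>e\<in>{e \<in> edges G. u \<in> e}. (Y e)\<^sup>2) = (\<Sum>x\<in>{x. (u, x) \<in> parcs G}. (y u x)\<^sup>2)"
      unfolding sum_incident_edges by (intro sum.cong) (auto simp: Y)
    also have "\<dots> \<le> (\<Sum>x\<in>{x. (u, x) \<in> parcs G}. (cmod (\<sigma> u x))\<^sup>2)"
      by (intro sum_mono) (auto simp: y_le)
    also have "\<dots> \<le> (\<Sum>x\<in>pverts G. (cmod (\<sigma> u x))\<^sup>2)"
      using pair_finite_verts arc_verts by (intro sum_mono2) auto
    finally show ?thesis using \<sigma>_norm[OF True] by simp
  next
    case False
    then have "{e \<in> edges G. u \<in> e} = {}" using edge_subset by auto
    then show ?thesis by (simp only: sum.empty)
  qed
  ultimately show ?thesis using that by blast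
qed

text \<open>The hypothesis is \<open>A^3 = c A\<close> read entrywise as sums over walks of length
  3. The trace of \<open>A * A\<close> counts the arcs, because the gains along an arc and its
  reverse multiply to 1.\<close>

lemma energy_of_cube:
  assumes cube: "\<And>u v. u \<in> pverts G \<Longrightarrow> v \<in> pverts G \<Longrightarrow>
      (\<Sum>x\<in>pverts G. \<Sum>z\<in>pverts G. gain u x * gain x z * gain z v) = of_real c * gain u v"
   
  shows "energy G \<phi> vs * sqrt c = 2 * real (card (edges G))"
proof -
  have "A * A * A = of_real c \<cdot>\<^sub>m A"
  proof (rule eq_matI)
    fix i j assume "i < dim_row (of_real c \<cdot>\<^sub>m A)" "j < dim_col (of_real c \<cdot>\<^sub>m A)"
    then have ij: "i < n" "j < n" using A_carrier by auto
    have "(A * A * A) $$ (i, j) = (\<Sum>l<n. \<Sum>k<n. A $$ (i, l) * A $$ (l, k) * A $$ (k, j))"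
      using ij A_carrier by (simp add: scalar_prod_def lessThan_atLeast0 sum_distrib_left mult.assoc)
    also have "\<dots> = (\<Sum>l<n. \<Sum>k<n. gain (vs ! i) (vs ! l) * gain (vs ! l) (vs ! k) * gain (vs ! k) (vs ! j))"
      using ij by (intro sum.cong) (simp_all add: A_index)
    also have "\<dots> = (\<Sum>x\<in>pverts G. \<Sum>z\<in>pverts G. gain (vs ! i) x * gain x z * gain z (vs ! j))"
      by (rule sum_nth_vs2[where f = "\<lambda>x z. gain (vs ! i) x * gain x z * gain z (vs ! j)"])
    also have "\<dots> = of_real c * gain (vs ! i) (vs ! j)"
      by (rule cube) (simp_all add: ij flip: set_vs)
    finally show "(A * A * A) $$ (i, j) = (of_real c \<cdot>\<^sub>m A) $$ (i, j)"
      using ij A_carrier by (simp add: A_index)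
  qed (use A_carrier in auto)
  from hermitian_cube_eigenvalue_sum[OF A_carrier A_hermitian this]
  have "energy G \<phi> vs * sqrt c = Re (mat_trace (A * A))" by (simp add: energy_def)
  also have "mat_trace (A * A) = (\<Sum>i<n. \<Sum>j<n. of_bool ((vs ! i, vs ! j) \<in> parcs G))"
    unfolding mat_trace_mult[OF A_carrier A_carrier]
    by (intro sum.cong) (simp_all add: A_index gain_sq)
  also have "\<dots> = (\<Sum>u\<in>pverts G. \<Sum>x\<in>pverts G. of_bool ((u, x) \<in> parcs G))"
    by (rule sum_nth_vs2[where f = "\<lambda>u x. of_bool ((u, x) \<in> parcs G)"])
  also have "\<dots> = (\<Sum>p\<in>pverts G \<times> pverts G. of_bool (p \<in> parcs G))"
    by (simp only: sum.cartesian_product case_prod_unfold prod.collapse)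
  also have "\<dots> = (\<Sum>p\<in>parcs G. 1)"
    using pair_finite_verts arc_verts by (intro sum.mono_neutral_cong_right) auto
  also have "Re \<dots> = (\<Sum>p\<in>parcs G. 1)" by simp
  also have "\<dots> = 2 * real (card (edges G))" using sum_parcs_edges[of "\<lambda>_. 1"] by simp
  finally show ?thesis .
qed

end

section \<open>Decomposition into double stars\<close>

text \<open>Abstract form of the double star estimate: \<open>a\<close> is the weight of the central
  edge, \<open>I\<close> holds its ends, and \<open>N x\<close> the edges assigned to the end
  \<open>x\<close>. With \<open>r = sqrt (1 - a^2)\<close>, Cauchy-Schwarz at each end reduces the
  total to \<open>a + s * r\<close>, where \<open>(a, r)\<close> is a unit vector.\<close>

lemma card_weight_sum_bound:
  fixes Y :: "'b \<Rightarrow> real" and a :: real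
  assumes I: "finite I" "I \<noteq> {}" and N: "\<And>x. x \<in> I \<Longrightarrow> finite (N x)"
    and sq: "\<And>x. x \<in> I \<Longrightarrow> a\<^sup>2 + (\<Sum>y\<in>N x. (Y y)\<^sup>2) \<le> 1"
  defines "s \<equiv> \<Sum>x\<in>I. sqrt (card (N x))"
  shows "a + (\<Sum>x\<in>I. \<Sum>y\<in>N x. Y y) \<le> sqrt (1 + s\<^sup>2)"
    and "a + (\<Sum>x\<in>I. \<Sum>y\<in>N x. Y y) = sqrt (1 + s\<^sup>2) \<Longrightarrow> a = 1 / sqrt (1 + s\<^sup>2)"
    and "a + (\<Sum>x\<in>I. \<Sum>y\<in>N x. Y y) = sqrt (1 + s\<^sup>2) \<Longrightarrow> x \<in> I \<Longrightarrow> y \<in> N x \<Longrightarrow>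
      Y y = s * a / sqrt (card (N x))"
proof -
  have "a\<^sup>2 \<le> 1"
  proof -
    obtain x where "x \<in> I" using I by blast
    then show ?thesis using sq[of x] sum_nonneg[of "N x" "\<lambda>y. (Y y)\<^sup>2"] by force
  qed
  define r where "r = sqrt (1 - a\<^sup>2)"
  have r: "r \<ge> 0" "a\<^sup>2 + r\<^sup>2 = 1" using \<open>a\<^sup>2 \<le> 1\<close> by (auto simp: r_def)
  have s: "s \<ge> 0" unfolding s_def by (intro sum_nonneg) simp
  have Nr: "(\<Sum>y\<in>N x. (Y y)\<^sup>2) \<le> r\<^sup>2" if "x \<in> I" for x using sq[OF that] r by simp
  have each: "(\<Sum>y\<in>N x. Y y) \<le> sqrt (card (N x)) * r" if "x \<in> I" for x
  proof (rule power2_le_imp_le)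
    have "(\<Sum>y\<in>N x. Y y)\<^sup>2 \<le> (\<Sum>y\<in>N x. (Y y)\<^sup>2) * card (N x)"
      by (rule sum_squared_le_sum_of_squares)
    also have "\<dots> \<le> r\<^sup>2 * card (N x)" using Nr[OF that] by (intro mult_right_mono) auto
    finally show "(\<Sum>y\<in>N x. Y y)\<^sup>2 \<le> (sqrt (card (N x)) * r)\<^sup>2"
      by (simp add: power_mult_distrib mult.commute)
  qed (use r in auto)
  have total: "(\<Sum>x\<in>I. \<Sum>y\<in>N x. Y y) \<le> s * r"
    using sum_mono[of I "\<lambda>x. \<Sum>y\<in>N x. Y y" "\<lambda>x. sqrt (card (N x)) * r"] each
    by (simp add: s_def sum_distrib_right)
  \<comment> \<open>Lagrange's identity for \<open>(1, s)\<close> and \<open>(a, r)\<close>: it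
    yields the bound, and equality forces the discarded square to vanish, so
    \<open>r = a * s\<close>.\<close>
  have lagrange: "(a + s * r)\<^sup>2 + (a * s - r)\<^sup>2 = 1 + s\<^sup>2"
  proof -
    have "(a + s * r)\<^sup>2 + (a * s - r)\<^sup>2 = (1 + s\<^sup>2) * (a\<^sup>2 + r\<^sup>2)"
      by (simp add: power2_eq_square algebra_simps)
    then show ?thesis using r by simp
  qed
  have bound: "a + s * r \<le> sqrt (1 + s\<^sup>2)"
  proof (rule real_le_rsqrt)
    show "(a + s * r)\<^sup>2 \<le> 1 + s\<^sup>2" using lagrange zero_le_power2[of "a * s - r"] by linarith
  qed
  show "a + (\<Sum>x\<in>I. \<Sum>y\<in>N x. Y y) \<le> sqrt (1 + s\<^sup>2)" using total bound by linarith
  assume eq: "a + (\<Sum>x\<in>I. \<Sum>y\<in>N x. Y y) = sqrt (1 + s\<^sup>2)"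
  then have "a + s * r = sqrt (1 + s\<^sup>2)" and eq': "(\<Sum>x\<in>I. \<Sum>y\<in>N x. Y y) = s * r"
    using total bound by linarith+
  from this(1) have "(a + s * r)\<^sup>2 = 1 + s\<^sup>2" by (simp add: add_nonneg_nonneg)
  then have r_eq: "r = a * s" using lagrange by simp
  have "a * (1 + s\<^sup>2) = sqrt (1 + s\<^sup>2)"
    using \<open>a + s * r = sqrt (1 + s\<^sup>2)\<close> r_eq by (simp add: power2_eq_square algebra_simps)
  define t where "t = sqrt (1 + s\<^sup>2)"
  have "1 + s\<^sup>2 = t * t" by (simp add: t_def add_nonneg_nonneg)
  then have "a * t * t = a * (1 + s\<^sup>2)" by (simp only: mult.assoc)
  also have "\<dots> = 1 * t" unfolding t_def mult_1 by fact
  finally have "(a * t) * t = 1 * t" .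
  moreover have "t > 0" by (simp add: t_def add_pos_nonneg)
  ultimately have "a * t = 1" by simp
  then show "a = 1 / sqrt (1 + s\<^sup>2)" using \<open>t > 0\<close> unfolding t_def by (simp add: eq_divide_eq)
  assume x: "x \<in> I" and y: "y \<in> N x"
  have each_eq: "(\<Sum>y\<in>N x. Y y) = sqrt (card (N x)) * r"
  proof (rule antisym[OF each[OF x]], rule ccontr)
    assume "\<not> sqrt (card (N x)) * r \<le> (\<Sum>y\<in>N x. Y y)"
    then have "(\<Sum>y\<in>N x. Y y) < sqrt (card (N x)) * r" by simp
    then have "\<exists>x\<in>I. (\<Sum>y\<in>N x. Y y) < sqrt (card (N x)) * r" using x by blast
    then have "(\<Sum>x\<in>I. \<Sum>y\<in>N x. Y y) < (\<Sum>x\<in>I. sqrt (card (N x)) * r)"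
      using I each by (intro sum_strict_mono_ex1) auto
    then show False using eq' by (simp add: s_def sum_distrib_right)
  qed
  \<comment> \<open>Equality in Cauchy-Schwarz means that all weights in \<open>N x\<close> agree.
    Their common value must be \<open>r / q\<close>, so the sum of squared deviations from
    \<open>r / q\<close> is shown to be at most 0.\<close>
  define q where "q = sqrt (card (N x))"
  have "card (N x) > 0" using y N[OF x] by (auto simp: card_gt_0_iff)
  then have q: "q > 0" "q\<^sup>2 = card (N x)" by (auto simp: q_def)
  have "(\<Sum>y\<in>N x. (Y y - r / q)\<^sup>2)
      = (\<Sum>y\<in>N x. (Y y)\<^sup>2) - 2 * (r / q) * (\<Sum>y\<in>N x. Y y) + card (N x) * (r / q)\<^sup>2"
    by (simp add: power2_diff sum.distrib sum_subtractf sum_distrib_left sum_divide_distrib algebra_simps)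
  also have "\<dots> = (\<Sum>y\<in>N x. (Y y)\<^sup>2) - 2 * (r / q) * (q * r) + q\<^sup>2 * (r / q)\<^sup>2"
    using each_eq q by (simp add: q_def)
  also have "\<dots> = (\<Sum>y\<in>N x. (Y y)\<^sup>2) - r\<^sup>2"
    using q(1) by (simp add: power2_eq_square)
  finally have "(\<Sum>y\<in>N x. (Y y - r / q)\<^sup>2) \<le> 0" using Nr[OF x] by simp
  moreover have "(Y y - r / q)\<^sup>2 \<le> (\<Sum>y\<in>N x. (Y y - r / q)\<^sup>2)"
    using y N[OF x] by (intro member_le_sum) auto
  ultimately have "(Y y - r / q)\<^sup>2 \<le> 0" by linarith
  then show "Y y = s * a / sqrt (card (N x))" by (simp add: r_eq q_def mult.commute)
qed

text \<open>For \<open>p \<noteq> q\<close> the integer square \<open>(p - q)^2\<close> is at least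
  1; for \<open>p = q\<close> and odd \<open>d\<close> the slack in \<open>2 * p + 1 \<le> d\<close>
  supplies the extra unit. This integrality is what separates the odd bound from the even
  one.\<close>

lemma four_mult_le_square:
  fixes p q d :: nat
  assumes "p + q \<le> d"
  shows "4 * p * q + d mod 2 \<le> d\<^sup>2"
proof (cases "p = q")
  case True
  show ?thesis
  proof (cases "even d")
    case True
    have "(2 * p)\<^sup>2 \<le> d\<^sup>2" using assms \<open>p = q\<close> by (intro power_mono) auto
    then show ?thesis using True \<open>p = q\<close> by (simp add: power2_eq_square)
  next
    case False
    then have "2 * p + 1 \<le> d" using assms \<open>p = q\<close> by presburger
    then have "(2 * p + 1)\<^sup>2 \<le> d\<^sup>2" by (intro power_mono) auto
    then show ?thesis using False \<open>p = q\<close> by (simp add: power2_eq_square odd_iff_mod_2_eq_one)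
  qed
next
  case False
  then have "(int p - int q)\<^sup>2 \<ge> 1" by (simp add: int_one_le_iff_zero_less)
  then have "4 * int p * int q + 1 \<le> (int p + int q)\<^sup>2"
    by (simp add: power2_eq_square algebra_simps)
  then have "int (4 * p * q + 1) \<le> int ((p + q)\<^sup>2)" by simp
  then have "4 * p * q + 1 \<le> (p + q)\<^sup>2" by (simp only: of_nat_le_iff)
  also have "\<dots> \<le> d\<^sup>2" using assms by (rule power_mono) simp
  finally have "4 * p * q + 1 \<le> d\<^sup>2" .
  moreover have "d mod 2 \<le> 1" by simp
  ultimately show ?thesis by linarith
qed

text \<open>Half the energy of a tree with \<open>d + 1\<close> edges that is a double star with balanced ends.\<close>

definition double_star_bound :: "nat \<Rightarrow> real" where
  "double_star_bound d = sqrt (1 + real d + sqrt (real d ^ 2 - real (d mod 2)))"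

lemma double_star_bound_pos: "double_star_bound d > 0"
proof -
  have "real (d mod 2) \<le> real d ^ 2"
    using four_mult_le_square[of 0 0 d] by (simp flip: of_nat_power)
  then show ?thesis by (simp add: double_star_bound_def add_pos_nonneg)
qed

text \<open>Expanding the square leaves the cross term \<open>sqrt (4 * p * q)\<close>, which the
  integer inequality controls.\<close>

lemma double_star_le:
  assumes "p + q \<le> d"
  shows "sqrt (1 + (sqrt (real p) + sqrt (real q))\<^sup>2) \<le> double_star_bound d"
proof -
  have "real (4 * p * q) \<le> real d ^ 2 - real (d mod 2)"
  proof -
    have "real (4 * p * q + d mod 2) \<le> real (d\<^sup>2)"
      using four_mult_le_square[OF assms] by (simp only: of_nat_le_iff)
    then show ?thesis by simp
  qed
  then have "sqrt (real (4 * p * q)) \<le> sqrt (real d ^ 2 - real (d mod 2))" by simp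
  moreover have "sqrt (real (4 * p * q)) = 2 * sqrt (real p) * sqrt (real q)"
    by (simp add: real_sqrt_mult)
  moreover have "(sqrt (real p) + sqrt (real q))\<^sup>2 = real p + real q + 2 * sqrt (real p) * sqrt (real q)"
    by (simp add: power2_sum)
  moreover have "real p + real q \<le> real d" using assms by simp
  ultimately have "1 + (sqrt (real p) + sqrt (real q))\<^sup>2 \<le> 1 + real d + sqrt (real d ^ 2 - real (d mod 2))"
    by linarith
  then show ?thesis unfolding double_star_bound_def by simp
qed

text \<open>If one end carries no further edge, the cross term vanishes, whereas for
  \<open>d \<ge> 2\<close> the inner root of \<open>double_star_bound d\<close> is positive. For
  \<open>d = 0\<close> and \<open>d = 1\<close> that root is 0, which is why these degrees
  escape.\<close>

lemma double_star_eqD: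
  assumes "p + q \<le> d" "sqrt (1 + (sqrt (real p) + sqrt (real q))\<^sup>2) = double_star_bound d" "d \<ge> 2"
  shows "p > 0 \<and> q > 0"
proof (rule ccontr)
  assume "\<not> (p > 0 \<and> q > 0)"
  then have "(sqrt (real p) + sqrt (real q))\<^sup>2 = real (p + q)" by auto
  moreover have "real d ^ 2 - real (d mod 2) > 0"
  proof -
    have "d mod 2 < 2" by simp
    also have "2 \<le> d\<^sup>2" using assms(3) power_mono[of 2 d 2] by simp
    finally show ?thesis by (simp flip: of_nat_power)
  qed
  then have "real d < real d + sqrt (real d ^ 2 - real (d mod 2))" by simp
  moreover have "real (p + q) \<le> real d" using assms(1) by simp
  ultimately have "sqrt (1 + (sqrt (real p) + sqrt (real q))\<^sup>2) < double_star_bound d"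
    unfolding double_star_bound_def by (simp only: real_sqrt_less_iff)
  then show False using assms(2) by simp
qed

section \<open>Maximum matchings and the double stars around their edges\<close>

lemma matchingD:
  assumes "matching G M" "e \<in> M" "f \<in> M" "e \<noteq> f"
  shows "e \<inter> f = {}"
  using assms by (auto simp: matching_def adjacent_edges_def)

context pair_graph
begin

lemma matching_subset: "matching G M \<Longrightarrow> M \<subseteq> edges G"
  by (simp add: matching_def)

lemma matching_finite: "matching G M \<Longrightarrow> finite M"
  using matching_subset finite_edges finite_subset by blast

lemma finite_matching_cards: "finite {card M | M. matching G M}"
proof -
  have "{card M | M. matching G M} \<subseteq> card ` Pow (edges G)" using matching_subset by auto
  then show ?thesis using finite_edges finite_subset by blast
qed

lemma card_matching_le: "matching G M \<Longrightarrow> card M \<le> matching_number G"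
  unfolding matching_number_def using finite_matching_cards by (intro Max_ge) auto

lemma maximum_matching_exists:
  obtains M where "matching G M" "card M = matching_number G"
proof -
  have "matching G {}" by (simp add: matching_def)
  then have "matching_number G \<in> {card M | M. matching G M}"
    unfolding matching_number_def using finite_matching_cards by (intro Max_in) auto
  then show ?thesis using that by force
qed

lemma edge_degree_le: "e \<in> edges G \<Longrightarrow> edge_degree G e \<le> max_edge_degree G"
  unfolding max_edge_degree_def using finite_edges by (intro Max_ge) auto

text \<open>An edge avoiding all matched vertices could be added to \<open>M\<close>, contradicting
  maximality.\<close>

lemma maximum_matching_covers:
  assumes M: "matching G M" "card M = matching_number G" and e: "e \<in> edges G"
  shows "e \<inter> \<Union>M \<noteq> {}"
proof
  assume disj: "e \<inter> \<Union>M = {}"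
  then have "matching G (insert e M)"
    using M e by (auto simp: matching_def adjacent_edges_def)
  moreover have "e \<noteq> {}" using e by (auto elim: edgeE)
  then have "e \<notin> M" using disj by auto
  then have "card (insert e M) = Suc (card M)" using matching_finite[OF M(1)] by simp
  ultimately show False using card_matching_le M(2) by force
qed

text \<open>
  Every edge outside a maximum matching \<open>M\<close> is assigned to one of its \<open>M\<close>-covered endpoints,
  chosen by \<open>f\<close>.  This cuts the edge set into \<open>card M\<close> double stars, one around each edge of \<open>M\<close>.
\<close>

context
  fixes M :: "'a set set" and f :: "'a set \<Rightarrow> 'a" and Y :: "'a set \<Rightarrow> real"
  assumes M: "matching G M" "card M = matching_number G"
    and f: "\<forall>e\<in>edges G - M. f e \<in> e \<inter> \<Union>M"
    and Y: "\<forall>u. (\<Sum>e\<in>{e \<in> edges G. u \<in> e}. (Y e)\<^sup>2) \<le> 1"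
begin

definition star :: "'a \<Rightarrow> 'a set set" where
  "star u = {e \<in> edges G - M. f e = u}"

text \<open>The quantity \<open>\<surd>p + \<surd>q\<close> of the double star around
  \<open>e\<close>.\<close>

definition star_root :: "'a set \<Rightarrow> real" where
  "star_root e = (\<Sum>u\<in>e. sqrt (card (star u)))"

lemma finite_star: "finite (star u)"
  using finite_edges by (simp add: star_def)

lemma star_incident: "e \<in> star u \<Longrightarrow> u \<in> e"
  using f by (auto simp: star_def)

text \<open>Edges outside \<open>M\<close> are grouped by their assigned vertex, and the covered
  vertices by the unique matching edge containing them.\<close>

lemma sum_edges_double_stars:
  "(\<Sum>e\<in>edges G. Y e) = (\<Sum>e\<in>M. Y e + (\<Sum>u\<in>e. \<Sum>e'\<in>star u. Y e'))"
proof -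
  have fin: "finite M" "\<And>e. e \<in> M \<Longrightarrow> finite e"
    using matching_finite[OF M(1)] matching_subset[OF M(1)] card_edge by (auto simp: card_ge_0_finite)
  have "(\<Sum>e\<in>edges G. Y e) = (\<Sum>e\<in>M. Y e) + (\<Sum>e\<in>edges G - M. Y e)"
    using sum.subset_diff[OF matching_subset[OF M(1)] finite_edges, of Y] by simp
  also have "(\<Sum>e\<in>edges G - M. Y e) = (\<Sum>u\<in>\<Union>M. \<Sum>e'\<in>star u. Y e')"
    unfolding star_def using finite_edges fin f by (intro sum.group[symmetric]) auto
  also have "\<dots> = (\<Sum>e\<in>M. \<Sum>u\<in>e. \<Sum>e'\<in>star u. Y e')"
    using fin matchingD[OF M(1)] by (subst sum.Union_disjoint) auto
  finally show ?thesis by (simp add: sum.distrib)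
qed

lemma star_weight_le:
  assumes "e \<in> M" "u \<in> e"
  shows "(Y e)\<^sup>2 + (\<Sum>e'\<in>star u. (Y e')\<^sup>2) \<le> 1"
proof -
  have "e \<notin> star u" using assms by (auto simp: star_def)
  then have "(Y e)\<^sup>2 + (\<Sum>e'\<in>star u. (Y e')\<^sup>2) = (\<Sum>e'\<in>insert e (star u). (Y e')\<^sup>2)"
    using finite_star by simp
  also have "\<dots> \<le> (\<Sum>e'\<in>{e' \<in> edges G. u \<in> e'}. (Y e')\<^sup>2)"
    using assms matching_subset[OF M(1)] star_incident finite_edges
    by (intro sum_mono2) (auto simp: star_def)
  finally show ?thesis using spec[OF Y, of u] by linarith
qed

text \<open>The stars at the ends of \<open>e\<close> are disjoint, as every edge is assigned only
  once, and all their edges are adjacent to \<open>e\<close>.\<close>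

lemma card_double_star_le:
  assumes e: "e \<in> M"
  shows "(\<Sum>u\<in>e. card (star u)) \<le> edge_degree G e"
proof -
  have "finite e" using e matching_subset[OF M(1)] card_edge by (auto simp: card_ge_0_finite)
  then have "(\<Sum>u\<in>e. card (star u)) = card (\<Union>u\<in>e. star u)"
    using finite_star by (intro card_UN_disjoint[symmetric]) (auto simp: star_def)
  also have "\<dots> \<le> edge_degree G e"
    unfolding edge_degree_def using finite_edges e star_incident
    by (intro card_mono) (auto simp: adjacent_edges_def star_def)
  finally show ?thesis .
qed

lemma double_star_root:
  assumes e: "e \<in> M"
  obtains u v where "e = {u, v}" "u \<noteq> v" "star_root e = sqrt (card (star u)) + sqrt (card (star v))"
    "card (star u) + card (star v) \<le> edge_degree G e" "edge_degree G e \<le> max_edge_degree G"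
proof -
  have "e \<in> edges G" using e matching_subset[OF M(1)] by blast
  then obtain u v where "e = {u, v}" "(u, v) \<in> parcs G" "u \<noteq> v" by (rule edgeE)
  then show ?thesis
    using that[of u v] card_double_star_le[OF e] e matching_subset[OF M(1)] edge_degree_le
    by (auto simp: star_root_def)
qed

lemma double_star_sum_le:
  assumes e: "e \<in> M"
  shows "Y e + (\<Sum>u\<in>e. \<Sum>e'\<in>star u. Y e') \<le> sqrt (1 + (star_root e)\<^sup>2)"
    and "sqrt (1 + (star_root e)\<^sup>2) \<le> double_star_bound (max_edge_degree G)"
    and "Y e + (\<Sum>u\<in>e. \<Sum>e'\<in>star u. Y e') = sqrt (1 + (star_root e)\<^sup>2) \<Longrightarrow>
      Y e = 1 / sqrt (1 + (star_root e)\<^sup>2)"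
    and "Y e + (\<Sum>u\<in>e. \<Sum>e'\<in>star u. Y e') = sqrt (1 + (star_root e)\<^sup>2) \<Longrightarrow> u \<in> e \<Longrightarrow> e' \<in> star u \<Longrightarrow>
      Y e' = star_root e * Y e / sqrt (card (star u))"
proof -
  have fin: "finite e" "e \<noteq> {}"
    using e matching_subset[OF M(1)] card_edge by (fastforce simp: card_ge_0_finite)+
  note * = card_weight_sum_bound[where I = e and N = star and Y = Y and a = "Y e",
      OF fin finite_star star_weight_le[OF e]]
  show "Y e + (\<Sum>u\<in>e. \<Sum>e'\<in>star u. Y e') \<le> sqrt (1 + (star_root e)\<^sup>2)" unfolding star_root_def by (rule *(1))
  show "Y e = 1 / sqrt (1 + (star_root e)\<^sup>2)"
    if "Y e + (\<Sum>u\<in>e. \<Sum>e'\<in>star u. Y e') = sqrt (1 + (star_root e)\<^sup>2)"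
    unfolding star_root_def by (rule *(2), assumption, rule that[unfolded star_root_def])
  show "Y e' = star_root e * Y e / sqrt (card (star u))"
    if "Y e + (\<Sum>u\<in>e. \<Sum>e'\<in>star u. Y e') = sqrt (1 + (star_root e)\<^sup>2)" "u \<in> e" "e' \<in> star u"
    unfolding star_root_def by (rule *(3), assumption, rule that(1)[unfolded star_root_def], rule that(2), rule that(3))
  show "sqrt (1 + (star_root e)\<^sup>2) \<le> double_star_bound (max_edge_degree G)"
    using double_star_root[OF e] double_star_le by (metis le_trans)
qed

lemma edge_weight_sum_le:
  "(\<Sum>e\<in>edges G. Y e) \<le> real (matching_number G) * double_star_bound (max_edge_degree G)"
  unfolding sum_edges_double_stars M(2)[symmetric]
  by (rule sum_bounded_above) (rule order_trans[OF double_star_sum_le(1) double_star_sum_le(2)])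

section \<open>Consequences of equality in the weight bound\<close>

context
  assumes eq: "(\<Sum>e\<in>edges G. Y e) = real (matching_number G) * double_star_bound (max_edge_degree G)"
begin

text \<open>A double star below the common bound could not be compensated by the others, so both
  inequalities are tight at every edge of \<open>M\<close>.\<close>

lemma double_star_eq:
  assumes e: "e \<in> M"
  shows "Y e + (\<Sum>u\<in>e. \<Sum>e'\<in>star u. Y e') = sqrt (1 + (star_root e)\<^sup>2)"
    and "sqrt (1 + (star_root e)\<^sup>2) = double_star_bound (max_edge_degree G)"
proof -
  let ?B = "double_star_bound (max_edge_degree G)"
  have "Y e + (\<Sum>u\<in>e. \<Sum>e'\<in>star u. Y e') = ?B"
  proof (rule ccontr)
    assume "Y e + (\<Sum>u\<in>e. \<Sum>e'\<in>star u. Y e') \<noteq> ?B"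
    then have "Y e + (\<Sum>u\<in>e. \<Sum>e'\<in>star u. Y e') < ?B"
      using double_star_sum_le(1,2)[OF e] by linarith
    then have "(\<Sum>e\<in>M. Y e + (\<Sum>u\<in>e. \<Sum>e'\<in>star u. Y e')) < (\<Sum>e\<in>M. ?B)"
      using double_star_sum_le(1,2) e matching_finite[OF M(1)]
      by (intro sum_strict_mono_ex1) (auto intro: order_trans)
    then show False using eq by (simp add: sum_edges_double_stars M(2))
  qed
  then show "Y e + (\<Sum>u\<in>e. \<Sum>e'\<in>star u. Y e') = sqrt (1 + (star_root e)\<^sup>2)"
    and "sqrt (1 + (star_root e)\<^sup>2) = ?B"
    using double_star_sum_le(1,2)[OF e] by linarith+
qed

lemma matching_edge_weight:
  assumes e: "e \<in> M"
  shows "Y e = 1 / double_star_bound (max_edge_degree G)"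
  using double_star_sum_le(3)[OF e] double_star_eq[OF e] by simp

lemma star_edge_weight:
  assumes "e \<in> M" "u \<in> e" "e' \<in> star u"
  shows "Y e' = star_root e * Y e / sqrt (card (star u))"
  using double_star_sum_le(4)[OF assms(1) _ assms(2,3)] double_star_eq[OF assms(1)] by simp

text \<open>The matching edge and the star already exhaust the budget of the vertex
  \<open>u\<close>, so no further edge of nonzero weight fits there. With \<open>B\<close> the
  double star bound, the sum is
  \<open>(1 + (star_root e)^2) * (Y e)^2 = B^2 * (1 / B)^2\<close>.\<close>

lemma star_saturated:
  assumes e: "e \<in> M" "u \<in> e" and ne: "star u \<noteq> {}"
  shows "(Y e)\<^sup>2 + (\<Sum>e'\<in>star u. (Y e')\<^sup>2) = 1"
proof -
  let ?B = "double_star_bound (max_edge_degree G)"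
  have c: "card (star u) > 0" using ne finite_star by (simp add: card_gt_0_iff)
  have "(\<Sum>e'\<in>star u. (Y e')\<^sup>2) = (\<Sum>e'\<in>star u. (star_root e * Y e)\<^sup>2 / card (star u))"
    using star_edge_weight[OF e] by (intro sum.cong) (simp_all add: power_divide)
  also have "\<dots> = (star_root e)\<^sup>2 * (Y e)\<^sup>2" using c by (simp add: power_mult_distrib)
  also have "(Y e)\<^sup>2 + \<dots> = (1 + (star_root e)\<^sup>2) * (Y e)\<^sup>2" by (simp add: algebra_simps)
  also have "1 + (star_root e)\<^sup>2 = ?B\<^sup>2"
    using double_star_eq(2)[OF e(1)] by (metis add_nonneg_nonneg real_sqrt_pow2 zero_le_one zero_le_power2)
  finally show ?thesis
    using matching_edge_weight[OF e(1)] double_star_bound_pos[of "max_edge_degree G"]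
    by (simp add: power_divide)
qed

text \<open>Both ends must carry edges, so \<open>star_root e\<close> has a positive contribution
  from the end opposite to \<open>u\<close>; the strict inequality later makes star edges heavier
  than matching edges.\<close>

lemma stars_nonempty:
  assumes e: "e \<in> M" "u \<in> e" and "max_edge_degree G \<ge> 2"
  shows "star u \<noteq> {}" "star_root e > sqrt (card (star u))"
proof -
  obtain v w where vw: "e = {v, w}" "v \<noteq> w" "star_root e = sqrt (card (star v)) + sqrt (card (star w))"
    "card (star v) + card (star w) \<le> max_edge_degree G"
    using double_star_root[OF e(1)] by (metis le_trans)
  then have "card (star v) > 0 \<and> card (star w) > 0"
    using double_star_eqD[OF vw(4)] double_star_eq(2)[OF e(1)] assms(3) by simp
  then show "star u \<noteq> {}" "star_root e > sqrt (card (star u))"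
    using e(2) vw by (auto simp del: card_gt_0_iff dest: card_gt_0_iff[THEN iffD1])
qed

end

end

lemma assignment_exists:
  assumes "matching G M" "card M = matching_number G"
  obtains f where "\<forall>e\<in>edges G - M. f e \<in> e \<inter> \<Union>M"
proof -
  have "\<forall>e\<in>edges G - M. \<exists>u. u \<in> e \<inter> \<Union>M"
    using maximum_matching_covers[OF assms] by (metis DiffD1 ex_in_conv)
  then show ?thesis using that by metis
qed

end

context pair_graph
begin

text \<open>
  At equality all edges of every maximum matching carry the same weight, whereas an edge assigned
  to a star carries a strictly larger one.  If its other endpoint is uncovered, it can be swapped
  into the matching; otherwise the weights at that endpoint exceed their budget.
\<close>

lemma edge_weight_sum_less:
  fixes Y :: "'a set \<Rightarrow> real"
  assumes Y: "\<forall>u. (\<Sum>e\<in>{e \<in> edges G. u \<in> e}. (Y e)\<^sup>2) \<le> 1"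
    and deg: "max_edge_degree G \<ge> 2" and pos: "matching_number G > 0"
  shows "(\<Sum>e\<in>edges G. Y e) < real (matching_number G) * double_star_bound (max_edge_degree G)"
proof -
  let ?B = "double_star_bound (max_edge_degree G)"
  obtain M where M: "matching G M" "card M = matching_number G" by (rule maximum_matching_exists)
  obtain f where f: "\<forall>e\<in>edges G - M. f e \<in> e \<inter> \<Union>M" by (rule assignment_exists[OF M])
  have "(\<Sum>e\<in>edges G. Y e) \<noteq> real (matching_number G) * ?B"
  proof
    assume eq: "(\<Sum>e\<in>edges G. Y e) = real (matching_number G) * ?B"
    note weight = matching_edge_weight[OF _ _ _ Y eq]
    obtain e where e: "e \<in> M" using pos M by fastforce
    then obtain u v where "e = {u, v}" using matching_subset[OF M(1)] unfolding edges_def by blast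
    then have u: "u \<in> e" by simp
    note ne = stars_nonempty[OF M f Y eq _ _ deg]
    obtain e' where e': "e' \<in> star M f u" using ne(1)[OF e u] by blast
    have e'G: "e' \<in> edges G" "e' \<notin> M" "f e' = u" using e' by (auto simp: star_def[OF M f Y])
    have "u \<in> e'" using star_incident[OF M f Y e'] .
    then obtain w where w: "e' = {u, w}" "u \<noteq> w" using e'G(1) by (auto elim!: edgeE)
    \<comment> \<open>The ratio of the weights of \<open>e'\<close> and \<open>e\<close> is
      \<open>star_root\<close> over the root of the star size, which exceeds 1 since the star at the
      other end of \<open>e\<close> is nonempty.\<close>
    have "Y e' = star_root M f e * Y e / sqrt (card (star M f u))"
      by (rule star_edge_weight[OF M f Y eq e u e'])
    moreover have "card (star M f u) > 0"
      using e' finite_star[OF M f Y] by (auto simp: card_gt_0_iff)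
    moreover have "Y e > 0" using weight[OF M f e] double_star_bound_pos by simp
    ultimately have larger: "Y e' > Y e"
      using ne(2)[OF e u] by (simp add: less_divide_eq mult.commute)
    show False
    proof (cases "w \<in> \<Union>M")
      case True
      then obtain e'' where e'': "e'' \<in> M" "w \<in> e''" by blast
      \<comment> \<open>The edges \<open>e''\<close> and \<open>star M f w\<close> saturate
        \<open>w\<close>. The edge \<open>e'\<close> is also incident with \<open>w\<close> but
        assigned to \<open>u\<close>, so it comes on top of them.\<close>
      have "1 + (Y e')\<^sup>2 = (\<Sum>x\<in>insert e' (insert e'' (star M f w)). (Y x)\<^sup>2)"
        using star_saturated[OF M f Y eq e'' ne(1)[OF e'']] finite_star[OF M f Y] e'G e'' w
        by (subst sum.insert) (auto simp: star_def[OF M f Y])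
      also have "\<dots> \<le> (\<Sum>x\<in>{x \<in> edges G. w \<in> x}. (Y x)\<^sup>2)"
        using e'' e'G w matching_subset[OF M(1)] star_incident[OF M f Y] finite_edges
        by (intro sum_mono2) (auto simp: star_def[OF M f Y])
      finally have "(Y e')\<^sup>2 \<le> 0" using spec[OF Y, of w] by linarith
      then show False using larger \<open>Y e > 0\<close> by simp
    next
      case False
      \<comment> \<open>The edge \<open>e'\<close> meets the covered vertices only in
        \<open>u\<close>, so exchanging it for \<open>e\<close> gives another maximum matching;
        equality then prescribes for \<open>e'\<close> the same weight as for
        \<open>e\<close>.\<close>
      let ?M = "insert e' (M - {e})"
      have "matching G ?M"
        using M(1) e'G False w u e matchingD[OF M(1) e]
        by (auto simp: matching_def adjacent_edges_def)
      moreover have "card ?M = matching_number G"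
        using M matching_finite[OF M(1)] e e'G pos by (simp add: card.insert_remove card_Diff_singleton)
      ultimately have M': "matching G ?M" "card ?M = matching_number G" .
      obtain f' where f': "\<forall>e\<in>edges G - ?M. f' e \<in> e \<inter> \<Union>?M"
        by (rule assignment_exists[OF M'])
      have "Y e' = 1 / ?B" using weight[OF M' f'] by blast
      then show False using weight[OF M f e] larger by simp
    qed
  qed
  then show ?thesis using edge_weight_sum_le[OF M f Y] by simp
qed

text \<open>The only alternative is a matching edge of degree 0 in a graph of maximum edge degree 1.
  Its stars are empty, so its estimate is 1, while equality demands \<open>sqrt 2\<close>.\<close>

lemma matching_edge_degrees:
  fixes Y :: "'a set \<Rightarrow> real"
  assumes Y: "\<forall>u. (\<Sum>e\<in>{e \<in> edges G. u \<in> e}. (Y e)\<^sup>2) \<le> 1"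
    and M: "matching G M" "card M = matching_number G" and deg: "max_edge_degree G \<le> 1"
    and eq: "(\<Sum>e\<in>edges G. Y e) = real (matching_number G) * double_star_bound (max_edge_degree G)"
    and e: "e \<in> M"
  shows "edge_degree G e = max_edge_degree G"
proof -
  obtain f where f: "\<forall>e\<in>edges G - M. f e \<in> e \<inter> \<Union>M" by (rule assignment_exists[OF M])
  show ?thesis
  proof (rule ccontr)
    assume "edge_degree G e \<noteq> max_edge_degree G"
    then have "edge_degree G e = 0" "max_edge_degree G = 1"
      using deg edge_degree_le matching_subset[OF M(1)] e by (force simp: le_Suc_eq)+
    moreover obtain v w where "star_root M f e = sqrt (card (star M f v)) + sqrt (card (star M f w))"
      "card (star M f v) + card (star M f w) \<le> edge_degree G e"
      using double_star_root[OF M f Y e] by metis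
    ultimately have "star_root M f e = 0" by simp
    then show False
      using double_star_eq(2)[OF M f Y eq e] \<open>max_edge_degree G = 1\<close> by (simp add: double_star_bound_def)
  qed
qed

end

section \<open>Disjoint unions of short paths\<close>

text \<open>Arcs are pairs of vertices, so the vertex map determines the arc map.\<close>

lemma digraph_iso_with_projI:
  assumes "pair_wf_digraph H" "inj_on g (pverts H)" "pverts K = g ` pverts H"
    "parcs K = map_prod g g ` parcs H"
  shows "digraph_iso (with_proj H) (with_proj K)"
proof -
  interpret pair_wf_digraph H by fact
  let ?f = "\<lparr>iso_verts = g, iso_arcs = map_prod g g, iso_head = snd, iso_tail = fst\<rparr>"
  have "inj_on (map_prod g g) (parcs H)"
    by (rule inj_on_subset[OF map_prod_inj_on[OF assms(2) assms(2)]]) (auto dest: in_arcsD1 in_arcsD2)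
  then have "digraph_isomorphism ?f"
    unfolding digraph_isomorphism_def using assms(2) wf_digraph_axioms by auto
  moreover have "with_proj K = app_iso ?f (with_proj H)"
    using assms(3,4) by (simp add: with_proj_def app_iso_def)
  ultimately show ?thesis unfolding digraph_iso_def by blast
qed

lemma digraph_iso_with_projE:
  assumes "digraph_iso (with_proj H) (with_proj K)"
  obtains g where "inj_on g (pverts H)" "pverts K = g ` pverts H" "parcs K = map_prod g g ` parcs H"
proof -
  obtain f where f: "pre_digraph.digraph_isomorphism (with_proj H) f" "with_proj K = app_iso f (with_proj H)"
    using assms unfolding digraph_iso_def by blast
  define g where "g = iso_verts f"
  have "pverts K = g ` pverts H" "parcs K = iso_arcs f ` parcs H" "iso_tail f = fst" "iso_head f = snd"
    using f(2) by (simp_all add: with_proj_def app_iso_def g_def)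
  moreover from this(3,4) have "iso_arcs f a = map_prod g g a" if "a \<in> parcs H" for a
    using f(1) that unfolding pre_digraph.digraph_isomorphism_def
    by (auto simp: g_def prod_eq_iff)
  moreover have "inj_on g (pverts H)"
    using f(1) by (simp add: pre_digraph.digraph_isomorphism_def g_def)
  ultimately show ?thesis using that[of g] by simp
qed

lemma parcs_path_graph:
  "parcs (path_graph 2) = {(0, 1), (1, 0)}"
  "parcs (path_graph 3) = {(0, 1), (1, 0), (1, 2), (2, 1)}"
  by (auto simp: path_graph_def)

lemma pverts_path_graph:
  "pverts (path_graph 2) = {0, 1}" "pverts (path_graph 3) = {0, 1, 2}"
  by (auto simp: path_graph_def)

lemma gain_path_2I:
  assumes "gain_graph H \<phi>" "pverts H = {u, v}" "parcs H = {(u, v), (v, u)}" "u \<noteq> v"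
  shows "gain_path 2 H \<phi>"
proof -
  interpret gain_graph H \<phi> by fact
  have "digraph_iso (with_proj H) (with_proj (path_graph 2))"
    by (rule digraph_iso_with_projI[OF pair_wf_digraph_axioms, of "\<lambda>x. if x = u then 0 else 1"])
      (use assms in \<open>auto simp: parcs_path_graph pverts_path_graph\<close>)
  then show ?thesis using assms(1) by (simp add: gain_path_def)
qed

lemma gain_path_3I:
  assumes "gain_graph H \<phi>" "pverts H = {u, v, w}" "parcs H = {(u, v), (v, u), (v, w), (w, v)}"
    "u \<noteq> v" "v \<noteq> w" "u \<noteq> w"
  shows "gain_path 3 H \<phi>"
proof -
  interpret gain_graph H \<phi> by fact
  have "digraph_iso (with_proj H) (with_proj (path_graph 3))"
    by (rule digraph_iso_with_projI[OF pair_wf_digraph_axioms, of "\<lambda>x. if x = u then 0 else if x = v then 1 else 2"])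
      (use assms(2-6) assms(4-6)[symmetric] in \<open>simp_all add: parcs_path_graph pverts_path_graph inj_on_def insert_commute\<close>)
  then show ?thesis using assms(1) by (simp add: gain_path_def)
qed

lemma gain_pathE:
  assumes "gain_path k H \<phi>"
  obtains h where "inj_on h (pverts (path_graph k))" "pverts H = h ` pverts (path_graph k)"
    "parcs H = map_prod h h ` parcs (path_graph k)"
proof -
  have "digraph_iso (with_proj H) (with_proj (path_graph k))" using assms by (simp add: gain_path_def)
  then obtain g where g: "inj_on g (pverts H)" "pverts (path_graph k) = g ` pverts H"
    "parcs (path_graph k) = map_prod g g ` parcs H"
    by (rule digraph_iso_with_projE)
  interpret gain_graph H \<phi> using assms by (simp add: gain_path_def)
  define h where "h = the_inv_into (pverts H) g"
  have h: "h (g x) = x" if "x \<in> pverts H" for x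
    unfolding h_def by (rule the_inv_into_f_f[OF g(1) that])
  show ?thesis
  proof
    show "inj_on h (pverts (path_graph k))"
      unfolding g(2) h_def by (rule inj_on_the_inv_into[OF g(1)])
    show "pverts H = h ` pverts (path_graph k)"
      unfolding g(2) by (force simp: h image_image)
    have "map_prod h h (map_prod g g a) = a" if "a \<in> parcs H" for a
      using that h arc_fst_in_verts arc_snd_in_verts by (cases a) force
    then show "parcs H = map_prod h h ` parcs (path_graph k)"
      unfolding g(3) image_image by simp
  qed
qed

lemma gain_path_2E:
  assumes "gain_path 2 H \<phi>"
  obtains u v where "u \<noteq> v" "pverts H = {u, v}" "parcs H = {(u, v), (v, u)}"
proof -
  obtain h where "inj_on h {0, 1::nat}" "pverts H = h ` {0, 1}" "parcs H = map_prod h h ` {(0, 1), (1, 0)}"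
    using gain_pathE[OF assms] unfolding parcs_path_graph pverts_path_graph .
  then show ?thesis using that[of "h 0" "h 1"] by (auto simp: inj_on_def)
qed

lemma gain_path_3E:
  assumes "gain_path 3 H \<phi>"
  obtains u v w where "u \<noteq> v" "v \<noteq> w" "u \<noteq> w" "pverts H = {u, v, w}"
    "parcs H = {(u, v), (v, u), (v, w), (w, v)}"
proof -
  obtain h where "inj_on h {0, 1, 2::nat}" "pverts H = h ` {0, 1, 2}"
    "parcs H = map_prod h h ` {(0, 1), (1, 0), (1, 2), (2, 1)}"
    using gain_pathE[OF assms] unfolding parcs_path_graph pverts_path_graph .
  then show ?thesis using that[of "h 0" "h 1" "h 2"] by (auto simp: inj_on_def)
qed

text \<open>Two distinct edges meeting a third would give it degree at least 2. Hence the edges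
  meeting a given edge form its whole connected component.\<close>

lemma (in pair_graph) intersecting_edges_trans:
  assumes deg: "max_edge_degree G \<le> 1" and e: "e \<in> edges G" "f \<in> edges G" "g \<in> edges G"
    and "e \<inter> f \<noteq> {}" "f \<inter> g \<noteq> {}"
  shows "e \<inter> g \<noteq> {}"
proof (cases "e = f \<or> g = f")
  case False
  then have "{e, g} \<subseteq> {h \<in> edges G. adjacent_edges f h}"
    using assms by (auto simp: adjacent_edges_def)
  then have "card {e, g} \<le> edge_degree G f"
    unfolding edge_degree_def using finite_edges by (intro card_mono) auto
  then have "card {e, g} \<le> 1" using edge_degree_le[OF e(2)] deg by linarith
  then have "e = g" by (cases "e = g") auto
  then show ?thesis using \<open>e \<inter> f \<noteq> {}\<close> by blast
qed (use assms in auto)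

context gain_graph
begin

lemma restrict_gain_graph:
  assumes "K \<subseteq> edges G"
  shows "gain_graph \<lparr>pverts = \<Union>K, parcs = {p \<in> parcs G. {fst p, snd p} \<in> K}\<rparr> \<phi>"
proof -
  have "\<Union>K \<subseteq> pverts G" using assms edge_subset by blast
  then have "finite (\<Union>K)" using pair_finite_verts finite_subset by blast
  then show ?thesis
    using pair_finite_arcs
    by unfold_locales
      (auto simp: symmetric_def insert_commute arc_irrefl arc_sym intro!: symI intro: gain_reverse dest: gain_in_circle)
qed

text \<open>Without an adjacent edge, \<open>e\<close> spans a \<open>P_2\<close>; with exactly one,
  the two edges form a \<open>P_3\<close> whose middle vertex is the shared endpoint.\<close>

lemma matching_neighbourhood_gain_path:
  assumes e: "e \<in> edges G" and deg: "edge_degree G e \<le> 1"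
  shows "gain_path (edge_degree G e + 2) \<lparr>pverts = \<Union>{f \<in> edges G. e \<inter> f \<noteq> {}},
    parcs = {p \<in> parcs G. {fst p, snd p} \<in> {f \<in> edges G. e \<inter> f \<noteq> {}}}\<rparr> \<phi>"
proof -
  define K where "K = {f \<in> edges G. e \<inter> f \<noteq> {}}"
  define H where "H = \<lparr>pverts = \<Union>K, parcs = {p \<in> parcs G. {fst p, snd p} \<in> K}\<rparr>"
  have H: "gain_graph H \<phi>" unfolding H_def by (rule restrict_gain_graph) (auto simp: K_def)
  obtain u v where uv: "e = {u, v}" "(u, v) \<in> parcs G" "u \<noteq> v" using edgeE[OF e] .
  have K: "K = insert e {f \<in> edges G. adjacent_edges e f}"
    using e uv by (auto simp: K_def adjacent_edges_def)
  consider "edge_degree G e = 0" | "edge_degree G e = 1" using deg by linarith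
  then have "gain_path (edge_degree G e + 2) H \<phi>"
  proof cases
    case 1
    then have empty: "{f \<in> edges G. adjacent_edges e f} = {}" using finite_edges by (simp add: edge_degree_def)
    have "K = {e}" unfolding K empty ..
    then have "pverts H = {u, v}" "parcs H = {(u, v), (v, u)}"
      using uv arc_sym[of u v] by (auto simp: H_def doubleton_eq_iff)
    from gain_path_2I[OF H this uv(3)] show ?thesis using 1 by (simp add: numeral_2_eq_2)
  next
    case 2
    then obtain e' where e': "{f \<in> edges G. adjacent_edges e f} = {e'}"
      unfolding edge_degree_def by (rule card_1_singletonE)
    then have *: "e' \<in> edges G" "e \<noteq> e'" "e \<inter> e' \<noteq> {}" by (auto simp: adjacent_edges_def)
    then obtain x where x: "x \<in> e" "x \<in> e'" by blast
    obtain y where y: "e = {x, y}" "(x, y) \<in> parcs G" "x \<noteq> y"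
      using x(1) uv arc_sym[of u v] by (cases "x = u") (auto simp: insert_commute)
    obtain z where z: "e' = {x, z}" "(x, z) \<in> parcs G" "x \<noteq> z"
    proof -
      obtain a b where "e' = {a, b}" "(a, b) \<in> parcs G" "a \<noteq> b" using edgeE[OF *(1)] .
      then show ?thesis
        using that[of a] that[of b] x(2) arc_sym[of a b] by (cases "x = a") (auto simp: insert_commute)
    qed
    have "y \<noteq> z" using * y z by auto
    have "K = {{x, y}, {x, z}}" using K e' y z by simp
    then have "pverts H = {y, x, z}" "parcs H = {(y, x), (x, y), (x, z), (z, x)}"
      using y z arc_sym[of x y] arc_sym[of x z] by (auto simp: H_def doubleton_eq_iff)
    from gain_path_3I[OF H this] have "gain_path 3 H \<phi>" using y z \<open>y \<noteq> z\<close> by simp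
    moreover have "edge_degree G e + 2 = 3" using 2 by simp
    ultimately show ?thesis by (simp only:)
  qed
  then show ?thesis by (simp only: H_def K_def)
qed

text \<open>Each matching edge generates its component. Transitivity of intersection keeps the
  components of distinct matching edges apart, maximality of \<open>M\<close> makes them exhaust the
  arcs, and the vertices left over are isolated.\<close>

lemma disjoint_gain_pathsI:
  assumes M: "matching G M" "card M = matching_number G" and deg: "max_edge_degree G \<le> 1"
    and degM: "\<And>e. e \<in> M \<Longrightarrow> edge_degree G e = max_edge_degree G"
  shows "disjoint_gain_paths (card M) (max_edge_degree G + 2) G \<phi>"
proof -
  define K where "K e = {f \<in> edges G. e \<inter> f \<noteq> {}}" for e
  define H where "H e = \<lparr>pverts = \<Union>(K e), parcs = {p \<in> parcs G. {fst p, snd p} \<in> K e}\<rparr>" for e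
  note ME = matching_subset[OF M(1)]
  have self: "e \<in> K e" if "e \<in> M" for e
    using that ME by (auto simp: K_def elim: edgeE)
  have disj: "pverts (H e) \<inter> pverts (H e') = {}" if e: "e \<in> M" "e' \<in> M" "e \<noteq> e'" for e e'
  proof (rule ccontr)
    assume "pverts (H e) \<inter> pverts (H e') \<noteq> {}"
    then obtain x f f' where f: "f \<in> K e" "f' \<in> K e'" "x \<in> f" "x \<in> f'" by (auto simp: H_def)
    have "f \<inter> f' \<noteq> {}" using f by blast
    have "e \<inter> f' \<noteq> {}"
      by (rule intersecting_edges_trans[OF deg, of e f f']) (use f e ME \<open>f \<inter> f' \<noteq> {}\<close> in \<open>auto simp: K_def\<close>)
    then have "e \<inter> e' \<noteq> {}"
      by (intro intersecting_edges_trans[OF deg, of e f' e']) (use f e ME in \<open>auto simp: K_def\<close>)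
    then show False using matchingD[OF M(1) e] by blast
  qed
  have verts_ne: "pverts (H e) \<noteq> {}" if "e \<in> M" for e
  proof -
    have "e \<noteq> {}" using that ME by (auto elim: edgeE)
    then show ?thesis using self[OF that] by (auto simp: H_def)
  qed
  have "inj_on H M"
  proof (rule inj_onI, rule ccontr)
    fix e e' assume "e \<in> M" "e' \<in> M" "H e = H e'" "e \<noteq> e'"
    then show False using disj[of e e'] verts_ne[of e] by simp
  qed
  then have "card (H ` M) = card M" by (rule card_image)
  moreover have "finite (H ` M)" using matching_finite[OF M(1)] by simp
  moreover have "gain_path (max_edge_degree G + 2) (H e) \<phi>" if "e \<in> M" for e
    using matching_neighbourhood_gain_path[of e] that ME degM[OF that] deg
    unfolding H_def K_def by auto
  moreover have "parcs G = (\<Union>h\<in>H ` M. parcs h)"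
  proof -
    have "\<exists>e\<in>M. {u, v} \<in> K e" if "(u, v) \<in> parcs G" for u v
    proof -
      have "{u, v} \<in> edges G" using that by (simp add: edge_iff_arc)
      moreover from maximum_matching_covers[OF M this] obtain e where "e \<in> M" "{u, v} \<inter> e \<noteq> {}" by blast
      ultimately show ?thesis by (auto simp: K_def)
    qed
    then show ?thesis by (auto simp: H_def)
  qed
  moreover have "pverts G = (\<Union>h\<in>H ` M. pverts h) \<union> (pverts G - (\<Union>h\<in>H ` M. pverts h))"
    using edge_subset by (auto simp: H_def K_def)
  moreover have "\<forall>h\<in>H ` M. \<forall>h'\<in>H ` M. h \<noteq> h' \<longrightarrow> pverts h \<inter> pverts h' = {}"
    using disj by blast
  moreover have "\<forall>h\<in>H ` M. pverts h \<inter> (pverts G - (\<Union>h\<in>H ` M. pverts h)) = {}" by blast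
  ultimately show ?thesis unfolding disjoint_gain_paths_def by blast
qed

end

section \<open>Energy of disjoint unions of short paths\<close>

context numbered_gain_graph
begin

definition nbrs :: "'a \<Rightarrow> 'a set" where "nbrs u = {x. (u, x) \<in> parcs G}"

text \<open>The vertex \<open>u\<close> is isolated, the centre of a star with \<open>c\<close>
  leaves, or a leaf of one. A walk of length 3 in a star backtracks through a leaf, where the gains
  cancel; there are \<open>c\<close> choices of that leaf, each leaving
  \<open>gain u v\<close>.\<close>

lemma gain_star_cube:
  assumes "nbrs u = {} \<or> (card (nbrs u) = c \<and> (\<forall>x\<in>nbrs u. nbrs x = {u})) \<or>
      (\<exists>m. nbrs u = {m} \<and> card (nbrs m) = c \<and> (\<forall>z\<in>nbrs m. nbrs z = {m}))"
  shows "(\<Sum>x\<in>pverts G. \<Sum>z\<in>pverts G. gain u x * gain x z * gain z v) = of_nat c * gain u v"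
proof -
  have sub: "nbrs x \<subseteq> pverts G" and zero: "y \<notin> nbrs x \<Longrightarrow> gain x y = 0" for x y
    using arc_verts by (auto simp: nbrs_def gain_def)
  have one: "y \<in> nbrs x \<Longrightarrow> gain x y * gain y x = 1" for x y
    by (simp add: nbrs_def gain_sq)
  have "(\<Sum>x\<in>pverts G. \<Sum>z\<in>pverts G. gain u x * gain x z * gain z v)
      = (\<Sum>x\<in>nbrs u. \<Sum>z\<in>pverts G. gain u x * gain x z * gain z v)"
    using sub zero pair_finite_verts by (intro sum.mono_neutral_right) auto
  also have "\<dots> = (\<Sum>x\<in>nbrs u. \<Sum>z\<in>nbrs x. gain u x * gain x z * gain z v)"
    using sub zero pair_finite_verts by (intro sum.cong refl sum.mono_neutral_right) auto
  also have "\<dots> = of_nat c * gain u v"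
    using assms
  proof (elim disjE exE conjE)
    assume "nbrs u = {}"
    then show ?thesis using zero[of v u] by simp
  next
    assume *: "card (nbrs u) = c" "\<forall>x\<in>nbrs u. nbrs x = {u}"
    then have "(\<Sum>x\<in>nbrs u. \<Sum>z\<in>nbrs x. gain u x * gain x z * gain z v) = (\<Sum>x\<in>nbrs u. gain u v)"
      using one by (intro sum.cong) auto
    then show ?thesis using * by simp
  next
    fix m assume *: "nbrs u = {m}" "card (nbrs m) = c" "\<forall>z\<in>nbrs m. nbrs z = {m}"
    show ?thesis
    proof (cases "v = m")
      case True
      then have "(\<Sum>x\<in>nbrs u. \<Sum>z\<in>nbrs x. gain u x * gain x z * gain z v) = (\<Sum>z\<in>nbrs m. gain u v)"
        using * one by (auto simp: mult.assoc intro!: sum.cong)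
      then show ?thesis using * by simp
    next
      case False
      then have "gain u v = 0" and "gain z v = 0" if "z \<in> nbrs m" for z
        using * zero that by auto
      then show ?thesis using * False zero[of v u] by (auto intro!: sum.neutral)
    qed
  qed
  finally show ?thesis .
qed

end

text \<open>Both kinds of components are stars with \<open>k - 1\<close> leaves, so the cube of the adjacency matrix
  is \<open>k - 1\<close> times the matrix itself, which determines the energy.\<close>

lemma (in numbered_gain_graph) disjoint_gain_pathsD:
  assumes "disjoint_gain_paths m k G \<phi>" and k: "k = 2 \<or> k = 3"
  shows "max_edge_degree G \<le> k - 2"
    and "energy G \<phi> vs = 2 * real m * sqrt (real (k - 1))"
proof -
  obtain \<H> I where fin: "finite \<H>" and card: "card \<H> = m"
    and path: "\<And>H. H \<in> \<H> \<Longrightarrow> gain_path k H \<phi>"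
    and disj: "\<And>H H'. H \<in> \<H> \<Longrightarrow> H' \<in> \<H> \<Longrightarrow> H \<noteq> H' \<Longrightarrow> pverts H \<inter> pverts H' = {}"
    and parcs: "parcs G = (\<Union>H\<in>\<H>. parcs H)"
    using assms(1) unfolding disjoint_gain_paths_def by (elim exE conjE) (rule that; simp)
  have wf: "pair_graph H" if "H \<in> \<H>" for H
    using path[OF that] by (simp add: gain_path_def gain_graph_def)
  \<comment> \<open>Disjointness of the copies closes each one under adjacency in \<open>G\<close>,
    so neighbourhoods can be computed within a single path.\<close>
  have comp: "(u, x) \<in> parcs H" if H: "H \<in> \<H>" "u \<in> pverts H" "(u, x) \<in> parcs G" for H u x
  proof -
    obtain H' where H': "H' \<in> \<H>" "(u, x) \<in> parcs H'" using H(3) parcs by auto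
    then have "u \<in> pverts H'" using pair_graph.arc_verts[OF wf] by blast
    then have "H' = H" using disj[of H H'] H'(1) H by blast
    then show ?thesis using H' by simp
  qed
  have nb: "nbrs u = {x. (u, x) \<in> parcs H}" if "H \<in> \<H>" "u \<in> pverts H" for H u
    using comp[OF that] that(1) parcs by (auto simp: nbrs_def)
  have edges_H: "card (edges H) = k - 1" if H: "H \<in> \<H>" for H
    using k
  proof
    assume "k = 2"
    then obtain a b where "a \<noteq> b" "parcs H = {(a, b), (b, a)}"
      using path[OF H] by (auto elim: gain_path_2E)
    then have "edges H = {{a, b}}" by (auto simp: edges_def)
    then show ?thesis using \<open>k = 2\<close> by simp
  next
    assume "k = 3"
    then obtain a b c where "a \<noteq> b" "b \<noteq> c" "a \<noteq> c" "parcs H = {(a, b), (b, a), (b, c), (c, b)}"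
      using path[OF H] by (auto elim: gain_path_3E)
    then have "edges H = {{a, b}, {b, c}}" "{a, b} \<noteq> {b, c}" by (auto simp: edges_def doubleton_eq_iff)
    then show ?thesis using \<open>k = 3\<close> by simp
  qed
  have edges_G: "edges G = (\<Union>H\<in>\<H>. edges H)"
    unfolding edges_def parcs by blast
  have edges_meet: "H = H'" if "H \<in> \<H>" "H' \<in> \<H>" "e \<in> edges H" "f \<in> edges H'" "e \<inter> f \<noteq> {}" for H H' e f
    using disj[OF that(1,2)] pair_graph.edge_subset[OF wf[OF that(1)] that(3)]
      pair_graph.edge_subset[OF wf[OF that(2)] that(4)] that(5) by blast
  have "edge_degree G e \<le> k - 2" if e: "e \<in> edges G" for e
  proof -
    obtain H where H: "H \<in> \<H>" "e \<in> edges H" using e edges_G by blast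
    have "{f \<in> edges G. adjacent_edges e f} \<subseteq> edges H - {e}"
    proof
      fix f assume f: "f \<in> {f \<in> edges G. adjacent_edges e f}"
      then obtain H' where H': "H' \<in> \<H>" "f \<in> edges H'" using edges_G by blast
      then have "H = H'" using edges_meet[OF H(1) H'(1) H(2) H'(2)] f by (simp add: adjacent_edges_def)
      then show "f \<in> edges H - {e}" using f H'(2) by (auto simp: adjacent_edges_def)
    qed
    then have "edge_degree G e \<le> card (edges H - {e})"
      unfolding edge_degree_def using pair_graph.finite_edges[OF wf[OF H(1)]] by (intro card_mono) auto
    then show ?thesis using edges_H[OF H(1)] H(2) by simp
  qed
  then show "max_edge_degree G \<le> k - 2"
    unfolding max_edge_degree_def using finite_edges by simp
  have "card (edges G) = (\<Sum>H\<in>\<H>. card (edges H))"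
    unfolding edges_G
  proof (rule card_UN_disjoint[OF fin])
    show "\<forall>H\<in>\<H>. finite (edges H)" using pair_graph.finite_edges[OF wf] by blast
    show "\<forall>H\<in>\<H>. \<forall>H'\<in>\<H>. H \<noteq> H' \<longrightarrow> edges H \<inter> edges H' = {}"
    proof (intro ballI impI, rule ccontr)
      fix H H' assume *: "H \<in> \<H>" "H' \<in> \<H>" "H \<noteq> H'" "edges H \<inter> edges H' \<noteq> {}"
      then obtain e where "e \<in> edges H" "e \<in> edges H'" by blast
      moreover from this have "e \<noteq> {}" by (auto simp: edges_def)
      ultimately show False using edges_meet[of H H' e e] * by blast
    qed
  qed
  then have card_edges: "card (edges G) = (k - 1) * m" using edges_H card by simp
  have "(\<Sum>x\<in>pverts G. \<Sum>z\<in>pverts G. gain u x * gain x z * gain z v) = of_nat (k - 1) * gain u v" for u v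
  proof (rule gain_star_cube, cases "nbrs u = {}")
    case False
    then obtain x where "(u, x) \<in> parcs G" by (auto simp: nbrs_def)
    then obtain H where H: "H \<in> \<H>" "(u, x) \<in> parcs H" using parcs by auto
    then have u: "u \<in> pverts H" using pair_graph.arc_verts[OF wf] by blast
    from k show "nbrs u = {} \<or> card (nbrs u) = k - 1 \<and> (\<forall>x\<in>nbrs u. nbrs x = {u}) \<or>
        (\<exists>m. nbrs u = {m} \<and> card (nbrs m) = k - 1 \<and> (\<forall>z\<in>nbrs m. nbrs z = {m}))"
    proof
      assume "k = 2"
      then obtain a b where "a \<noteq> b" and verts: "pverts H = {a, b}" and "parcs H = {(a, b), (b, a)}"
        using path[OF H(1)] by (auto elim: gain_path_2E)
      then have "nbrs a = {b}" "nbrs b = {a}" using nb[OF H(1)] by auto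
      then show ?thesis using u verts \<open>k = 2\<close> by auto
    next
      assume "k = 3"
      then obtain a b c where "a \<noteq> b" "b \<noteq> c" "a \<noteq> c" and verts: "pverts H = {a, b, c}"
        and "parcs H = {(a, b), (b, a), (b, c), (c, b)}"
        using path[OF H(1)] by (auto elim: gain_path_3E)
      then have "nbrs a = {b}" "nbrs b = {a, c}" "nbrs c = {b}" using nb[OF H(1)] by auto
      then show ?thesis using u verts \<open>k = 3\<close> \<open>a \<noteq> c\<close> by auto
    qed
  qed simp
  then have "energy G \<phi> vs * sqrt (real (k - 1)) = 2 * real (card (edges G))"
    by (intro energy_of_cube) simp_all
  also have "\<dots> = 2 * real m * sqrt (real (k - 1)) * sqrt (real (k - 1))"
    by (simp add: card_edges)
  finally show "energy G \<phi> vs = 2 * real m * sqrt (real (k - 1))"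
    using k by auto
qed

text \<open>Both parities at once: the path order \<open>max_edge_degree G mod 2 + 2\<close> is 2 or
  3. Equality forces degree at most 1, where \<open>mod 2\<close> changes nothing; conversely, such
  a union has maximum edge degree 0 or 1 and a known energy.\<close>

lemma (in numbered_gain_graph) energy_bound:
  "energy G \<phi> vs \<le> 2 * real (matching_number G) * double_star_bound (max_edge_degree G)"
  "energy G \<phi> vs = 2 * real (matching_number G) * double_star_bound (max_edge_degree G) \<longleftrightarrow>
    disjoint_gain_paths (matching_number G) (max_edge_degree G mod 2 + 2) G \<phi>"
proof -
  let ?d = "max_edge_degree G" and ?m = "matching_number G"
  obtain Y where E: "energy G \<phi> vs = 2 * (\<Sum>e\<in>edges G. Y e)"
    and Y: "\<forall>u. (\<Sum>e\<in>{e \<in> edges G. u \<in> e}. (Y e)\<^sup>2) \<le> 1"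
    by (rule energy_edge_weights)
  obtain M where M: "matching G M" "card M = ?m" by (rule maximum_matching_exists)
  obtain f where f: "\<forall>e\<in>edges G - M. f e \<in> e \<inter> \<Union>M" by (rule assignment_exists[OF M])
  show "energy G \<phi> vs \<le> 2 * real ?m * double_star_bound ?d"
    using edge_weight_sum_le[OF M f Y] E by simp
  show "energy G \<phi> vs = 2 * real ?m * double_star_bound ?d \<longleftrightarrow>
    disjoint_gain_paths ?m (?d mod 2 + 2) G \<phi>" (is "?L \<longleftrightarrow> ?R")
  proof
    assume ?L
    then have eq: "(\<Sum>e\<in>edges G. Y e) = real ?m * double_star_bound ?d" using E by simp
    have deg: "?d \<le> 1"
    proof (rule ccontr)
      assume "\<not> ?d \<le> 1"
      \<comment> \<open>The strict bound requires a nonempty matching. If the maximum matching were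
        empty there would be no edges, and the maximum edge degree would be 0 by convention.\<close>
      moreover have "?m > 0"
      proof (rule ccontr)
        assume "\<not> ?m > 0"
        then have "M = {}" using M matching_finite[OF M(1)] by simp
        then have "edges G = {}" using maximum_matching_covers[OF M] by blast
        then show False using \<open>\<not> ?d \<le> 1\<close> by (simp add: max_edge_degree_def)
      qed
      ultimately show False using edge_weight_sum_less[OF Y] eq by simp
    qed
    then have "?d mod 2 = ?d" by simp
    then show ?R
      using disjoint_gain_pathsI[OF M deg matching_edge_degrees[OF Y M deg eq]] M(2) by simp
  next
    assume R: ?R
    have "?d mod 2 + 2 = 2 \<or> ?d mod 2 + 2 = 3" by auto
    note D = disjoint_gain_pathsD[OF R this]
    \<comment> \<open>Paths on \<open>k\<close> vertices allow edge degree at most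
      \<open>k - 2\<close>, which here is the parity of the degree itself.\<close>
    have "?d \<le> ?d mod 2" using D(1) by simp
    then have "?d = 0 \<or> ?d = 1" by (cases "even ?d") auto
    then show ?L using D(2) by (auto simp: double_star_bound_def)
  qed
qed

section \<open>Closed forms of the double star bound\<close>

lemma double_star_bound_even: "even d \<Longrightarrow> double_star_bound d = sqrt (2 * real d + 1)"
  by (simp add: double_star_bound_def)

text \<open>Both sides are nonnegative and have equal squares, since the product of the radicands is
  \<open>b^2 - 4 * b = 4 * (d^2 - 1)\<close>.\<close>

lemma double_star_bound_odd:
  assumes "odd d"
  defines "b \<equiv> 2 * (real d + 1)"
  shows "sqrt (b + 2 * sqrt b) + sqrt (b - 2 * sqrt b) = 2 * double_star_bound d"
proof -
  have d: "real d \<ge> 1" using assms(1) by (cases d) auto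
  have b: "b \<ge> 4" using d by (simp add: b_def)
  \<comment> \<open>This keeps the second radicand nonnegative; it rests on
    \<open>b \<ge> 4\<close>, that is, on \<open>d \<ge> 1\<close>.\<close>
  have "2 * sqrt b \<le> b"
  proof -
    have "2 \<le> sqrt b" using b by (intro real_le_rsqrt) simp
    then have "2 * sqrt b \<le> sqrt b * sqrt b" using b by (intro mult_right_mono) auto
    then show ?thesis using b by simp
  qed
  then have nonneg: "b + 2 * sqrt b \<ge> 0" "b - 2 * sqrt b \<ge> 0" using b by auto
  have "(b + 2 * sqrt b) * (b - 2 * sqrt b) = b\<^sup>2 - 4 * (sqrt b)\<^sup>2"
    by (simp add: power2_eq_square algebra_simps)
  also have "\<dots> = 2\<^sup>2 * (real d ^ 2 - 1)"
    using b by (simp add: b_def power2_eq_square algebra_simps)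
  finally have prod: "sqrt (b + 2 * sqrt b) * sqrt (b - 2 * sqrt b) = 2 * sqrt (real d ^ 2 - 1)"
    by (simp only: real_sqrt_mult[symmetric]) (simp only: real_sqrt_mult real_sqrt_abs abs_numeral)
  have "(sqrt (b + 2 * sqrt b) + sqrt (b - 2 * sqrt b))\<^sup>2 = 2 * b + 4 * sqrt (real d ^ 2 - 1)"
    using nonneg prod by (simp add: power2_sum mult.commute)
  also have "\<dots> = (2 * double_star_bound d)\<^sup>2"
    using assms(1) d by (simp add: double_star_bound_def power_mult_distrib b_def odd_iff_mod_2_eq_one)
  finally show ?thesis
    by (rule power2_eq_imp_eq)
      (use nonneg less_imp_le[OF double_star_bound_pos[of d]] in \<open>auto intro: add_nonneg_nonneg\<close>)
qed

theorem theorem4p4: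
  fixes G :: "'a pair_pre_digraph" and \<phi> :: "'a \<times> 'a \<Rightarrow> complex"
    and vs :: "'a list" and \<mu> \<Delta> :: nat
  assumes "gain_graph G \<phi>"
    and "distinct vs" and "set vs = pverts G"
    and "\<mu> = matching_number G"
    and "\<Delta> = max_edge_degree G"
  shows "(even \<Delta> \<longrightarrow>
            energy G \<phi> vs \<le> 2 * real \<mu> * sqrt (2 * real \<Delta> + 1) \<and>
            (energy G \<phi> vs = 2 * real \<mu> * sqrt (2 * real \<Delta> + 1)
              \<longleftrightarrow> disjoint_gain_paths \<mu> 2 G \<phi>)) \<and>
         (odd \<Delta> \<longrightarrow>
            (let b = 2 * (real \<Delta> + 1) in
              energy G \<phi> vs \<le> real \<mu> * (sqrt (b + 2 * sqrt b) + sqrt (b - 2 * sqrt b)) \<and>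
              (energy G \<phi> vs = real \<mu> * (sqrt (b + 2 * sqrt b) + sqrt (b - 2 * sqrt b))
                \<longleftrightarrow> disjoint_gain_paths \<mu> 3 G \<phi>)))"
proof -
  interpret numbered_gain_graph G \<phi> vs
    using assms(1-3) by (simp add: numbered_gain_graph_def numbered_gain_graph_axioms_def)
  note bound = energy_bound[folded assms(4,5)]
  show ?thesis
  proof (intro conjI impI)
    assume even: "even \<Delta>"
    then show "energy G \<phi> vs \<le> 2 * real \<mu> * sqrt (2 * real \<Delta> + 1)"
      using bound(1) by (simp add: double_star_bound_even)
    show "energy G \<phi> vs = 2 * real \<mu> * sqrt (2 * real \<Delta> + 1) \<longleftrightarrow> disjoint_gain_paths \<mu> 2 G \<phi>"
    proof -
      have "\<Delta> mod 2 + 2 = 2" using even by presburger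
      then show ?thesis using bound(2) by (simp only: double_star_bound_even[OF even])
    qed
  next
    assume odd: "odd \<Delta>"
    then have "\<Delta> mod 2 + 2 = 3" by presburger
    then show "let b = 2 * (real \<Delta> + 1) in
        energy G \<phi> vs \<le> real \<mu> * (sqrt (b + 2 * sqrt b) + sqrt (b - 2 * sqrt b)) \<and>
        (energy G \<phi> vs = real \<mu> * (sqrt (b + 2 * sqrt b) + sqrt (b - 2 * sqrt b))
          \<longleftrightarrow> disjoint_gain_paths \<mu> 3 G \<phi>)"
      using bound unfolding Let_def double_star_bound_odd[OF odd] by (simp only: mult.assoc mult.left_commute)
  qed
qed

end
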